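(* Let $2<k<N$ be integers, and for $p>0$ consider the equation $$\mathcal{P}^+_k(D^2u(x))+u^p(x)=0\quad\text{in }\mathbb{R}^N.\qquad ( * )$$ (1) For $0<p\le\frac{k}{k-2}$ the only nonnegative viscosity supersolution of $( * )$ is $u\equiv 0$. (2) For $p>\frac{k}{k-2}$ there exist positive classical supersolutions of $( * )$. (3) For $p\ge\frac{k+2}{k-2}$ there exist positive classical solutions of $( * )$. (4) For $p\in\left(\frac{k}{k-2},\frac{k+2}{k-2}\right)$ there are no radial positive classical solutions of $( * )$.
   Context: For a symmetric $N\times N$ real matrix $X$ with ordered eigenvalues $\lambda_1(X)\le\cdots\le\lambda_N(X)$, set $\mathcal{P}^+_k(X)=\sum_{i=N-k+1}^N\lambda_i(X)$. A nonnegative viscosity supersolution of $\mathcal{P}^+_k(D^2u)+u^p=0$ in an open set $\Omega$ is a lower semicontinuous function $u:\Omega\to[0,+\infty)$ such that, for every $x_0\in\Omega$ and every $C^2$ function $\varphi$ such that $u-\varphi$ has a local minimum at $x_0$, one has $\mathcal{P}^+_k(D^2\varphi(x_0))+u(x_0)^p\le 0$. A classical solution (resp. supersolution) is a $C^2$ function satisfying $\mathcal{P}^+_k(D^2u)+u^p=0$ (resp. $\le 0$) pointwise. "Positive" means $u>0$ everywhere; "radial" means $u(x)$ depends only on $|x|$. *)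

theory Defs
  imports "HOL-Analysis.Analysis" "HOL-Computational_Algebra.Polynomial"
begin

definition characteristic_poly :: "real^'n^'n \<Rightarrow> real poly" where
  "characteristic_poly A = det (\<chi> i j. (if i = j then [:0, 1:] else 0) - [:A $ i $ j:])"

text \<open>All real roots of the characteristic polynomial, repeated according to their multiplicity.
  For a symmetric matrix the resulting list has length \<open>CARD('n)\<close>.\<close>

definition ordered_eigenvalues :: "real^'n^'n \<Rightarrow> real list" where
  "ordered_eigenvalues A = sorted_list_of_multiset (proots (characteristic_poly A))"

text \<open>The index \<open>i\<close> runs from \<open>1\<close> to \<open>CARD('n)\<close>, whereas list positions start at \<open>0\<close>.\<close>

definition eigval :: "nat \<Rightarrow> real^'n^'n \<Rightarrow> real" where
  "eigval i A = ordered_eigenvalues A ! (i - 1)"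

definition Pplus :: "nat \<Rightarrow> real^'n^'n \<Rightarrow> real" where
  "Pplus k A = (\<Sum>i = CARD('n) - k + 1..CARD('n). eigval i A)"

definition gradient :: "(real^'n \<Rightarrow> real) \<Rightarrow> real^'n \<Rightarrow> real^'n" where
  "gradient u x = (\<chi> i. frechet_derivative u (at x) (axis i 1))"

definition hessian :: "(real^'n \<Rightarrow> real) \<Rightarrow> real^'n \<Rightarrow> real^'n^'n" where
  "hessian u x = matrix (frechet_derivative (gradient u) (at x))"

text \<open>The predicates below are meant for open sets \<open>S\<close>; the values of the functions outside
  \<open>S\<close> are then irrelevant.\<close>

definition C2_on :: "(real^'n) set \<Rightarrow> (real^'n \<Rightarrow> real) \<Rightarrow> bool" where
  "C2_on S u \<longleftrightarrow>
     (\<forall>x\<in>S. u differentiable (at x)) \<and>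
     (\<forall>x\<in>S. gradient u differentiable (at x)) \<and>
     continuous_on S (hessian u)"

definition lower_semicontinuous_on :: "'a::topological_space set \<Rightarrow> ('a \<Rightarrow> real) \<Rightarrow> bool" where
  "lower_semicontinuous_on S u \<longleftrightarrow>
     (\<forall>x\<in>S. \<forall>a<u x. eventually (\<lambda>y. a < u y) (at x within S))"

definition local_min_on :: "'a::topological_space set \<Rightarrow> ('a \<Rightarrow> real) \<Rightarrow> 'a \<Rightarrow> bool" where
  "local_min_on S f x \<longleftrightarrow> x \<in> S \<and> eventually (\<lambda>y. f x \<le> f y) (at x within S)"

definition nonneg_viscosity_supersolution ::
  "nat \<Rightarrow> real \<Rightarrow> (real^'n) set \<Rightarrow> (real^'n \<Rightarrow> real) \<Rightarrow> bool" where
  "nonneg_viscosity_supersolution k p S u \<longleftrightarrow>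
     (\<forall>x\<in>S. 0 \<le> u x) \<and>
     lower_semicontinuous_on S u \<and>
     (\<forall>x\<in>S. \<forall>\<phi>. C2_on S \<phi> \<and> local_min_on S (\<lambda>y. u y - \<phi> y) x \<longrightarrow>
        Pplus k (hessian \<phi> x) + u x powr p \<le> 0)"

definition classical_solution ::
  "nat \<Rightarrow> real \<Rightarrow> (real^'n) set \<Rightarrow> (real^'n \<Rightarrow> real) \<Rightarrow> bool" where
  "classical_solution k p S u \<longleftrightarrow>
     C2_on S u \<and> (\<forall>x\<in>S. Pplus k (hessian u x) + u x powr p = 0)"

definition classical_supersolution ::
  "nat \<Rightarrow> real \<Rightarrow> (real^'n) set \<Rightarrow> (real^'n \<Rightarrow> real) \<Rightarrow> bool" where
  "classical_supersolution k p S u \<longleftrightarrow>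
     C2_on S u \<and> (\<forall>x\<in>S. Pplus k (hessian u x) + u x powr p \<le> 0)"

definition radial :: "('a::real_normed_vector \<Rightarrow> 'b) \<Rightarrow> bool" where
  "radial u \<longleftrightarrow> (\<forall>x y. norm x = norm y \<longrightarrow> u x = u y)"

end

theory Submission
  imports Defs "HOL-Computational_Algebra.Fundamental_Theorem_Algebra" "HOL-Real_Asymp.Real_Asymp"
begin

text \<open>
  Everything rests on radial functions \<open>u(x) = g(s)\<close>, \<open>s = \<bar>x - z\<bar>\<^sup>2\<close>. The Hessian is
  \<open>2 g' I + 4 g'' y y\<^sup>T\<close> with \<open>y = x - z\<close>, so all eigenvalues but one equal \<open>2 g'\<close> and, because
  \<open>k < N\<close>, the sum of the \<open>k\<close> largest ones is \<open>2 k g' + max 0 (4 s g'')\<close> (\<open>Pplus_radial\<close>,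
  \<open>radial_C2\<close>). For convex \<open>g\<close> this is the Laplacian in dimension \<open>k\<close>, and for every \<open>g\<close> it is at
  least that Laplacian. The exponents in the theorem are therefore the Serrin exponent
  \<open>k / (k - 2)\<close> and the Sobolev exponent \<open>(k + 2) / (k - 2)\<close> of dimension \<open>k\<close>.

  Liouville property (\<open>liouville_supersolution\<close>): put \<open>b = k / 2 - 1\<close>. A supersolution that is
  positive at \<open>z\<close> is compared outside a small ball with perturbations of the fundamental solution
  \<open>s\<^bsup>-b\<^esup>\<close>, which gives \<open>u \<ge> c (1 + s)\<^bsup>-b\<^esup>\<close>. For \<open>p \<le> k / (k - 2)\<close> the source
  \<open>u\<^sup>p\<close> is then at least of the order \<open>(1 + s)\<^bsup>-b-1\<^esup>\<close>, and a second comparison improves the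
  bound by a logarithm. On the other hand, sliding a multiple of the bump \<open>s (\<epsilon> + s)\<^bsup>-a-1\<^esup>\<close>,
  \<open>a > b\<close>, under the graph of \<open>u\<close> touches \<open>u\<close> at a point with \<open>s\<close> comparable to \<open>\<epsilon>\<close>, where the
  inequality forces \<open>u\<^bsup>p-1\<^esup> \<le> C / \<epsilon>\<close>. Letting \<open>\<epsilon>\<close> tend to infinity contradicts the
  logarithmic bound if \<open>p > 1\<close>; if \<open>p \<le> 1\<close> it contradicts the trivial bound \<open>u \<le> C \<epsilon>\<close> at the
  touching point. That zero is a supersolution is the statement that the Hessian has no positive
  eigenvalue at a local maximum; since eigenvalues are roots of the characteristic polynomial,
  this uses that a symmetric matrix has \<open>N\<close> real ones.

  For \<open>p > k / (k - 2)\<close> a small multiple of \<open>(1 + s)\<^bsup>-1/(p-1)\<^esup>\<close> is a supersolution.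

  For \<open>p \<ge> (k + 2) / (k - 2)\<close> the Emden-Fowler equation \<open>4 s g'' + 2 k g' + g\<^sup>p = 0\<close>, \<open>g(0) = 1\<close>,
  has a solution by Banach's fixed point theorem for a truncated nonlinearity. Pohozaev's identity
  excludes a zero, and \<open>g'\<close> is a weighted average of \<open>- g\<^sup>p\<close>, hence increasing, so that \<open>g\<close> is convex
  and solves the equation for \<open>Pplus\<close> as well.

  For exponents in between, a radial solution \<open>f(r)\<close> must satisfy \<open>f'' \<ge> f' / r\<close>, hence solves the
  \<open>k\<close>-dimensional Emden-Fowler equation. Its Pohozaev function now increases strictly from \<open>0\<close>,
  while the decay of \<open>f\<close> and \<open>f'\<close> bounds it from above by a function that tends to \<open>0\<close>.
\<close>

section \<open>Eigenvalues of symmetric matrices\<close>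

lemma poly_det:
  fixes M :: "('a::comm_ring_1) poly^'n^'n"
  shows "poly (det M) x = det (\<chi> i j. poly (M $ i $ j) x)"
  by (simp add: det_def poly_sum poly_prod)

lemma poly_characteristic_poly:
  fixes A :: "real^'n^'n"
  shows "poly (characteristic_poly A) x = det (mat x - A)"
  unfolding characteristic_poly_def poly_det
  by (rule arg_cong[where f = det]) (simp add: vec_eq_iff mat_def)

text \<open>Only the identity permutation contributes to the leading term of the characteristic polynomial:
  every other product contains a constant factor.\<close>

lemma degree_prod_less:
  fixes f :: "'i \<Rightarrow> real poly"
  assumes "finite I" "\<And>i. i \<in> I \<Longrightarrow> degree (f i) \<le> 1" "j \<in> I" "degree (f j) = 0"
  shows "degree (prod f I) < card I"
proof -
  have "degree (prod f I) \<le> (\<Sum>i\<in>I. degree (f i))"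
    using degree_prod_sum_le[OF assms(1), of f] by (simp add: o_def)
  also have "\<dots> < (\<Sum>i\<in>I. 1)"
    using assms by (intro sum_strict_mono_ex1) auto
  finally show ?thesis by simp
qed

lemma degree_characteristic_poly:
  fixes A :: "real^'n^'n"
  shows "degree (characteristic_poly A) = CARD('n)" "characteristic_poly A \<noteq> 0"
proof -
  let ?M = "(\<chi> i j. (if i = j then [:0, 1:] else 0) - [:A $ i $ j:]) :: real poly^'n^'n"
  let ?t = "\<lambda>p. of_int (sign p) * (\<Prod>i\<in>UNIV. ?M $ i $ p i)"
  let ?S = "{p. p permutes (UNIV :: 'n set)}"
  have deg: "degree (?M $ i $ j) \<le> 1" for i j
    by (auto intro: order_trans[OF degree_diff_le_max])
  have other: "degree (?t p) < CARD('n)" if p: "p \<in> ?S - {id}" for p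
  proof -
    obtain j where "p j \<noteq> j" using p by (auto simp: fun_eq_iff)
    then have "degree (\<Prod>i\<in>UNIV. ?M $ i $ p i) < CARD('n)"
      by (intro degree_prod_less[where j = j] deg) auto
    then show ?thesis by (cases "evenperm p") (simp_all add: sign_def)
  qed
  have "(\<Prod>i\<in>UNIV. ?M $ i $ id i) = (\<Prod>i\<in>UNIV. [:- A $ i $ i, 1:])"
    by (intro prod.cong) auto
  moreover have "degree (\<Prod>i\<in>(UNIV :: 'n set). [:- A $ i $ i, 1:]) = CARD('n)"
    by (subst degree_prod_eq_sum_degree) auto
  ultimately have d: "degree (?t id) = CARD('n)" by simp
  have rest: "degree (sum ?t (?S - {id})) < CARD('n)"
  proof -
    have "degree (?t p) \<le> CARD('n) - 1" if "p \<in> ?S - {id}" for p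
      using other[OF that] by linarith
    then have "degree (sum ?t (?S - {id})) \<le> CARD('n) - 1"
      by (intro degree_sum_le) (simp_all add: finite_permutations)
    moreover have "0 < CARD('n)" by (rule zero_less_card_finite)
    ultimately show ?thesis by linarith
  qed
  have "characteristic_poly A = ?t id + sum ?t (?S - {id})"
    unfolding characteristic_poly_def det_def
    by (subst sum.remove[where x = id]) (auto simp: finite_permutations permutes_id)
  then show *: "degree (characteristic_poly A) = CARD('n)"
    using d rest degree_add_eq_left[of "sum ?t (?S - {id})" "?t id"] by simp
  then show "characteristic_poly A \<noteq> 0"
    by (metis degree_0 less_irrefl zero_less_card_finite)
qed

text \<open>A real polynomial splits into linear factors over the reals as soon as all its complex roots are
  real: the fundamental theorem of algebra provides a root, and the corresponding factor is split off.\<close>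

lemma size_proots_eq_degree:
  fixes p :: "real poly"
  assumes "p \<noteq> 0" "\<And>z :: complex. poly (map_poly of_real p) z = 0 \<Longrightarrow> z \<in> \<real>"
  shows "size (proots p) = degree p"
  using assms
proof (induction "degree p" arbitrary: p)
  case 0
  then show ?case by (metis degree_eq_zeroE proots_const size_empty zero_multiset_def)
next
  case (Suc n)
  let ?P = "map_poly of_real p :: complex poly"
  have "degree ?P = degree p" by (simp add: degree_map_poly)
  then have "\<not> constant (poly ?P)"
    using Suc.hyps(2) by (simp add: constant_degree)
  then obtain z where z: "poly ?P z = 0"
    using fundamental_theorem_of_algebra by blast
  then obtain a where a: "z = of_real a" using Suc.prems(2) by (metis Reals_cases)
  have hom: "poly (map_poly of_real q) (of_real x) = (of_real (poly q x) :: complex)" for q x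
    by (induction q) (auto simp: map_poly_pCons)
  have "poly p a = 0" using z hom[of p a] by (simp add: a)
  then obtain q where q: "p = [:-a, 1:] * q" by (metis poly_eq_0_iff_dvd dvdE)
  have q0: "q \<noteq> 0" using Suc.prems(1) q by auto
  have mult: "map_poly of_real (r * q) = (map_poly of_real r * map_poly of_real q :: complex poly)" for r q
    by (simp add: poly_eq_iff coeff_map_poly coeff_mult)
  have dq: "degree p = Suc (degree q)" using q0 by (subst q, subst degree_mult_eq) auto
  have "size (proots q) = degree q"
  proof (rule Suc.hyps(1))
    show "n = degree q" using dq Suc.hyps(2) by simp
    show "z \<in> \<real>" if "poly (map_poly of_real q) z = 0" for z :: complex
      using that Suc.prems(2)[of z] by (simp only: q mult poly_mult) simp
  qed (fact q0)
  then show ?case using q0 dq by (simp add: q proots_mult del: mult_pCons_left)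
qed

text \<open>The Hermitian form \<open>v\<^sup>* A v = z \<bar>v\<bar>\<^sup>2\<close> of a real symmetric matrix is its own conjugate.\<close>

lemma complex_eigenvalue_symmetric_real:
  fixes A :: "real^'n^'n" and v :: "complex^'n"
  assumes sym: "transpose A = A" and "v \<noteq> 0"
    and ev: "\<And>i. (\<Sum>j\<in>UNIV. of_real (A $ i $ j) * v $ j) = z * v $ i"
  shows "z \<in> \<real>"
proof -
  have A: "A $ i $ j = A $ j $ i" for i j
  proof -
    have "transpose A $ i $ j = A $ j $ i" by (simp add: transpose_def)
    then show ?thesis unfolding sym .
  qed
  define Q where "Q = (\<Sum>i\<in>UNIV. \<Sum>j\<in>UNIV. cnj (v $ i) * of_real (A $ i $ j) * v $ j)"
  define S where "S = (\<Sum>i\<in>UNIV. (cmod (v $ i))\<^sup>2)"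
  have "cnj Q = (\<Sum>i\<in>UNIV. \<Sum>j\<in>UNIV. v $ i * of_real (A $ i $ j) * cnj (v $ j))"
    by (simp only: Q_def cnj_sum complex_cnj_mult complex_cnj_cnj complex_cnj_complex_of_real)
  also have "\<dots> = (\<Sum>j\<in>UNIV. \<Sum>i\<in>UNIV. v $ i * of_real (A $ i $ j) * cnj (v $ j))"
    by (rule sum.swap)
  also have "\<dots> = Q" unfolding Q_def by (intro sum.cong refl) (simp add: A mult_ac)
  finally have QR: "Q \<in> \<real>" by (simp add: Reals_cnj_iff)
  have "Q = (\<Sum>i\<in>UNIV. cnj (v $ i) * (\<Sum>j\<in>UNIV. of_real (A $ i $ j) * v $ j))"
    by (simp add: Q_def sum_distrib_left mult.assoc)
  also have "\<dots> = (\<Sum>i\<in>UNIV. z * of_real ((cmod (v $ i))\<^sup>2))"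
    unfolding ev by (intro sum.cong refl) (simp only: complex_norm_square mult_ac)
  also have "\<dots> = z * of_real S" by (simp add: S_def sum_distrib_left)
  finally have "z * of_real S \<in> \<real>" using QR by simp
  moreover have "S \<noteq> 0"
  proof
    assume "S = 0"
    then have "\<forall>i\<in>UNIV. (cmod (v $ i))\<^sup>2 = 0" by (subst (asm) S_def, subst (asm) sum_nonneg_eq_0_iff) auto
    then show False using \<open>v \<noteq> 0\<close> by (simp add: vec_eq_iff)
  qed
  ultimately show ?thesis by (metis Reals_divide Reals_of_real nonzero_mult_div_cancel_right of_real_eq_0_iff)
qed

lemma det_eq_0_null_vector:
  fixes M :: "'a::field^'n^'n"
  assumes "det M = 0"
  obtains v where "v \<noteq> 0" "M *v v = 0"
proof -
  have "\<not> (\<exists>B. B ** M = mat 1)"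
    using assms by (metis invertible_det_nz invertible_left_inverse)
  then show ?thesis using that by (auto simp: matrix_left_invertible_ker)
qed

lemma map_poly_characteristic_poly:
  fixes A :: "real^'n^'n" and z :: complex
  shows "poly (map_poly of_real (characteristic_poly A)) z
     = det (\<chi> i j. (if i = j then z else 0) - of_real (A $ i $ j))"
proof -
  let ?h = "map_poly of_real :: real poly \<Rightarrow> complex poly"
  have mult: "?h (r * q) = ?h r * ?h q" for r q
    by (simp add: poly_eq_iff coeff_map_poly coeff_mult)
  have add: "?h (r + q) = ?h r + ?h q" for r q
    by (simp add: poly_eq_iff coeff_map_poly)
  have diff: "?h (r - q) = ?h r - ?h q" for r q
    by (simp add: poly_eq_iff coeff_map_poly)
  have sum: "?h (sum f S) = (\<Sum>i\<in>S. ?h (f i))" for f :: "('n \<Rightarrow> 'n) \<Rightarrow> real poly" and S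
    by (induction S rule: infinite_finite_induct) (auto simp: add)
  have prod: "?h (prod f S) = (\<Prod>i\<in>S. ?h (f i))" for f :: "'n \<Rightarrow> real poly" and S
    by (induction S rule: infinite_finite_induct) (auto simp: mult map_poly_1)
  have sgn: "?h (of_int (sign p)) = of_int (sign p)" for p :: "'n \<Rightarrow> 'n"
    by (simp add: sign_def map_poly_1 poly_eq_iff coeff_map_poly coeff_1)
  have "?h (characteristic_poly A) = det (\<chi> i j. (if i = j then [:0, 1:] else 0) - [:of_real (A $ i $ j):])"
    unfolding characteristic_poly_def det_def
    by (auto simp: sum prod mult sgn diff map_poly_pCons intro!: sum.cong prod.cong)
  then show ?thesis
    unfolding poly_det by (simp add: poly_det if_distrib[where f = "\<lambda>p. poly p z"] cong: if_cong)
qed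

text \<open>This is what makes \<open>eigval i A\<close> meaningful for all \<open>i \<le> N\<close>; for a shorter list of eigenvalues
  the positions beyond its end would be arbitrary.\<close>

lemma length_eigenvalues_symmetric:
  fixes A :: "real^'n^'n"
  assumes "transpose A = A"
  shows "length (ordered_eigenvalues A) = CARD('n)"
proof -
  have "size (proots (characteristic_poly A)) = degree (characteristic_poly A)"
  proof (rule size_proots_eq_degree)
    fix z :: complex
    assume "poly (map_poly of_real (characteristic_poly A)) z = 0"
    then have "det (\<chi> i j. (if i = j then z else 0) - of_real (A $ i $ j) :: complex^'n^'n) = 0"
      by (simp add: map_poly_characteristic_poly)
    then obtain v :: "complex^'n" where v: "v \<noteq> 0"
      "(\<chi> i j. (if i = j then z else 0) - of_real (A $ i $ j)) *v v = 0"
      by (rule det_eq_0_null_vector)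
    then have "(\<Sum>j\<in>UNIV. ((if i = j then z else 0) - of_real (A $ i $ j)) * v $ j) = 0" for i
      by (simp add: matrix_vector_mult_def vec_eq_iff)
    then have "(\<Sum>j\<in>UNIV. of_real (A $ i $ j) * v $ j) = z * v $ i" for i
      by (simp add: left_diff_distrib sum_subtractf if_distrib[where f = "\<lambda>x. x * _"] cong: if_cong)
    then show "z \<in> \<real>"
      using complex_eigenvalue_symmetric_real[OF assms v(1)] by blast
  qed (rule degree_characteristic_poly)
  then show ?thesis
    by (metis degree_characteristic_poly(1) mset_sorted_list_of_multiset ordered_eigenvalues_def size_mset)
qed

text \<open>Each eigenvalue has an eigenvector, on which the quadratic form has the sign of the eigenvalue.\<close>

lemma Pplus_nonpos:
  fixes A :: "real^'n^'n"
  assumes sym: "transpose A = A" and neg: "\<And>v. v \<bullet> (A *v v) \<le> 0"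
  shows "Pplus k A \<le> 0"
  unfolding Pplus_def
proof (rule sum_nonpos)
  fix i assume i: "i \<in> {CARD('n) - k + 1..CARD('n)}"
  then have "eigval i A \<in> set (ordered_eigenvalues A)"
    unfolding eigval_def
    by (intro nth_mem) (use length_eigenvalues_symmetric[OF sym] in simp, linarith)
  then have "poly (characteristic_poly A) (eigval i A) = 0"
    by (simp add: ordered_eigenvalues_def degree_characteristic_poly)
  then obtain v :: "real^'n" where v: "v \<noteq> 0" "(mat (eigval i A) - A) *v v = 0"
    unfolding poly_characteristic_poly by (rule det_eq_0_null_vector)
  have "mat c *v w = c *\<^sub>R w" for c and w :: "real^'n"
    by (simp add: vec_eq_iff matrix_vector_mult_def mat_def if_distrib[where f = "\<lambda>x. x * _"] cong: if_cong)
  then have "A *v v = eigval i A *\<^sub>R v"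
    using v(2) by (simp add: matrix_vector_mult_diff_rdistrib)
  then have "eigval i A * (v \<bullet> v) \<le> 0" using neg[of v] by simp
  moreover have "v \<bullet> v > 0" using v(1) by simp
  ultimately show "eigval i A \<le> 0" by (simp add: mult_le_0_iff)
qed

text \<open>A rotation that maps a coordinate axis to the line through \<open>y\<close> diagonalises the matrix.\<close>

lemma det_rank_one_update:
  fixes y :: "real^'n"
  shows "det (\<chi> i j. (if i = j then c else 0) - b * (y $ i * y $ j)) = c ^ (CARD('n) - 1) * (c - b * (norm y)\<^sup>2)"
proof -
  obtain m :: 'n where True by simp
  have "norm (norm y *\<^sub>R (axis m 1 :: real^'n)) = norm y" by simp
  then obtain f :: "real^'n \<Rightarrow> real^'n" where f: "orthogonal_transformation f" "f (norm y *\<^sub>R axis m 1) = y"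
    using orthogonal_transformation_exists[of "norm y *\<^sub>R axis m 1" y] by blast
  define Q where "Q = matrix f"
  have Q: "orthogonal_matrix Q" using f(1) by (simp add: Q_def orthogonal_transformation_matrix)
  have lin: "linear f" using f(1) by (simp add: orthogonal_transformation_def)
  have Qy: "y $ i = norm y * Q $ i $ m" for i
  proof -
    have "y = Q *v (norm y *\<^sub>R axis m 1)" using f(2) lin by (simp add: Q_def)
    then have "y $ i = norm y * (Q *v axis m 1) $ i" by (metis matrix_vector_mult_scaleR real_scaleR_def vector_scaleR_component)
    then show ?thesis by (simp add: matrix_vector_mult_def axis_def if_distrib[where f = "\<lambda>x. _ * x"] cong: if_cong)
  qed
  define D :: "real^'n^'n" where "D = (\<chi> i j. if i = j then (if i = m then c - b * (norm y)\<^sup>2 else c) else 0)"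
  have QQ: "(\<Sum>l\<in>UNIV. Q $ i $ l * Q $ j $ l) = (if i = j then 1 else 0)" for i j
  proof -
    have "(Q ** transpose Q) $ i $ j = (mat 1 :: real^'n^'n) $ i $ j" using Q by (simp add: orthogonal_matrix_def)
    then show ?thesis by (simp add: matrix_matrix_mult_def transpose_def mat_def)
  qed
  have "(\<chi> i j. (if i = j then c else 0) - b * (y $ i * y $ j)) = Q ** D ** transpose Q"
  proof -
    have "(Q ** D ** transpose Q) $ i $ j = (if i = j then c else 0) - b * (y $ i * y $ j)" for i j
    proof -
      have "(Q ** D) $ i $ l = Q $ i $ l * (if l = m then c - b * (norm y)\<^sup>2 else c)" for l
        by (simp add: matrix_matrix_mult_def D_def if_distrib[where f = "\<lambda>x. _ * x"] cong: if_cong)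
      then have "(Q ** D ** transpose Q) $ i $ j
        = (\<Sum>l\<in>UNIV. Q $ i $ l * (if l = m then c - b * (norm y)\<^sup>2 else c) * Q $ j $ l)"
        by (subst matrix_matrix_mult_def) (simp add: transpose_def)
      also have "\<dots> = (\<Sum>l\<in>UNIV. c * (Q $ i $ l * Q $ j $ l) - (if l = m then b * (norm y)\<^sup>2 * (Q $ i $ l * Q $ j $ l) else 0))"
        by (intro sum.cong) (auto simp: algebra_simps)
      also have "\<dots> = c * (\<Sum>l\<in>UNIV. Q $ i $ l * Q $ j $ l) - b * (norm y)\<^sup>2 * (Q $ i $ m * Q $ j $ m)"
        by (simp add: sum_subtractf sum_distrib_left)
      finally show ?thesis by (simp add: QQ Qy[of i] Qy[of j] power2_eq_square)
    qed
    then show ?thesis by (simp add: vec_eq_iff)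
  qed
  moreover have "det (Q ** D ** transpose Q) = det D"
  proof -
    have "det Q * det (transpose Q) = 1" using Q
      by (metis det_I det_mul orthogonal_matrix_def)
    then show ?thesis by (simp add: det_mul mult.commute mult.left_commute)
  qed
  moreover have "det D = (\<Prod>i\<in>UNIV. if i = m then c - b * (norm y)\<^sup>2 else c)"
    by (subst det_diagonal) (auto simp: D_def)
  moreover have "\<dots> = c ^ (CARD('n) - 1) * (c - b * (norm y)\<^sup>2)"
    by (subst prod.remove[where x = m]) (auto simp: card_Diff_singleton)
  ultimately show ?thesis by simp
qed

text \<open>The eigenvalues are \<open>a\<close>, with multiplicity at least \<open>N - 1\<close>, and \<open>a + b \<bar>y\<bar>\<^sup>2\<close>. The latter comes
  last or first in the ordered list according to the sign of \<open>b\<close>; since \<open>k < N\<close>, it is left out of the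
  sum in the second case.\<close>

lemma Pplus_radial:
  fixes y :: "real^'n"
  assumes "k < CARD('n)" "0 < k"
  shows "Pplus k (\<chi> i j. (if i = j then a else 0) + b * (y $ i * y $ j)) = real k * a + max 0 (b * (norm y)\<^sup>2)"
    (is "Pplus k ?A = _")
proof -
  let ?N = "CARD('n)" and ?g = "b * (norm y)\<^sup>2"
  have "characteristic_poly ?A = [:-a, 1:] ^ (?N - 1) * [:-(a + ?g), 1:]"
  proof (rule poly_ext)
    fix x
    have "mat x - ?A = (\<chi> i j. (if i = j then x - a else 0) - b * (y $ i * y $ j))"
      by (simp add: vec_eq_iff mat_def)
    then show "poly (characteristic_poly ?A) x = poly ([:-a, 1:] ^ (?N - 1) * [:-(a + ?g), 1:]) x"
      by (simp add: poly_characteristic_poly det_rank_one_update poly_power algebra_simps)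
  qed
  then have "proots (characteristic_poly ?A) = repeat_mset (?N - 1) {#a#} + {#a + ?g#}"
    by (simp add: proots_mult proots_power del: mult_pCons_right)
  also have "repeat_mset (?N - 1) {#a#} = replicate_mset (?N - 1) a"
    by (simp add: multiset_eq_iff)
  finally have roots: "proots (characteristic_poly ?A) = mset (replicate (?N - 1) a @ [a + ?g])" by simp
  have N: "0 < ?N" by simp
  have idx: "Pplus k ?A = (\<Sum>i = ?N - k + 1..?N. eigval i ?A)" by (simp add: Pplus_def)
  also have "\<dots> = (\<Sum>i = ?N - k..<?N. ordered_eigenvalues ?A ! i)"
    using assms by (intro sum.reindex_bij_witness[where i = Suc and j = "\<lambda>i. i - 1"]) (auto simp: eigval_def)
  finally have P: "Pplus k ?A = (\<Sum>i = ?N - k..<?N. ordered_eigenvalues ?A ! i)" .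
  show ?thesis
  proof (cases "0 \<le> ?g")
    case True
    have "ordered_eigenvalues ?A = replicate (?N - 1) a @ [a + ?g]"
      unfolding ordered_eigenvalues_def roots
      using True by (simp only: sorted_list_of_multiset_mset) (intro sorted_sort_id, auto simp: sorted_append)
    then have "Pplus k ?A = (\<Sum>i = ?N - k..<?N. a + (if i = ?N - 1 then ?g else 0))"
      unfolding P by (auto simp: nth_append intro!: sum.cong)
    also have "\<dots> = real k * a + ?g" using assms by (simp add: sum.distrib)
    finally show ?thesis using True by simp
  next
    case False
    have "mset (replicate (?N - 1) a @ [a + ?g]) = mset ((a + ?g) # replicate (?N - 1) a)" by simp
    then have "ordered_eigenvalues ?A = (a + ?g) # replicate (?N - 1) a"
      unfolding ordered_eigenvalues_def roots
      using False by (simp only: sorted_list_of_multiset_mset) (intro sorted_sort_id, auto)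
    then have "ordered_eigenvalues ?A ! i = a" if "i \<in> {?N - k..<?N}" for i
      using that assms by (cases i) (simp_all add: less_diff_conv)
    then have "Pplus k ?A = (\<Sum>i = ?N - k..<?N. a)"
      unfolding P by (rule sum.cong[OF refl])
    also have "\<dots> = real k * a" using assms by simp
    finally show ?thesis using False by simp
  qed
qed

section \<open>Radial functions and second derivatives\<close>

lemma gradient_unique:
  fixes u :: "real^'n \<Rightarrow> real"
  assumes "(u has_derivative (\<lambda>h. w \<bullet> h)) (at x)"
  shows "gradient u x = w"
proof -
  have "frechet_derivative u (at x) = (\<lambda>h. w \<bullet> h)"
    using assms by (metis frechet_derivative_at)
  then show ?thesis by (simp add: gradient_def vec_eq_iff inner_axis)
qed

lemma has_derivative_gradient:
  fixes u :: "real^'n \<Rightarrow> real"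
  assumes "u differentiable (at x)"
  shows "(u has_derivative (\<lambda>h. gradient u x \<bullet> h)) (at x)"
proof -
  let ?D = "frechet_derivative u (at x)"
  have D: "(u has_derivative ?D) (at x)" using assms by (simp add: frechet_derivative_works)
  then have lin: "linear ?D" by (simp add: has_derivative_linear)
  have "?D h = gradient u x \<bullet> h" for h
  proof -
    have "?D h = ?D (\<Sum>i\<in>UNIV. (h $ i) *\<^sub>R axis i 1)"
      by (simp add: basis_expansion flip: scalar_mult_eq_scaleR)
    also have "\<dots> = (\<Sum>i\<in>UNIV. h $ i * ?D (axis i 1))"
      by (simp add: linear_sum[OF lin] linear_scale[OF lin])
    also have "\<dots> = gradient u x \<bullet> h"
      by (simp add: gradient_def inner_vec_def mult.commute)
    finally show ?thesis .
  qed
  then show ?thesis using D by (metis (no_types, lifting) ext)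
qed

lemma has_derivative_hessian:
  fixes u :: "real^'n \<Rightarrow> real"
  assumes "gradient u differentiable (at x)"
  shows "(gradient u has_derivative (\<lambda>h. hessian u x *v h)) (at x)"
proof -
  have D: "(gradient u has_derivative frechet_derivative (gradient u) (at x)) (at x)"
    using assms by (simp add: frechet_derivative_works)
  then have lin: "linear (frechet_derivative (gradient u) (at x))" by (simp add: has_derivative_linear)
  then have "(\<lambda>h. hessian u x *v h) = frechet_derivative (gradient u) (at x)"
    by (simp add: hessian_def matrix_works fun_eq_iff)
  then show ?thesis using D by simp
qed

text \<open>The common shape of the Hessians of radial functions, \<open>y\<close> being the position relative to the centre.\<close>

definition radial_matrix :: "real \<Rightarrow> real \<Rightarrow> real^'n \<Rightarrow> real^'n^'n" where
  "radial_matrix a b y = (\<chi> i j. (if i = j then a else 0) + b * (y $ i * y $ j))"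

lemma radial_matrix_mult: "radial_matrix a b y *v h = a *\<^sub>R h + (b * (y \<bullet> h)) *\<^sub>R y"
proof -
  have "(radial_matrix a b y *v h) $ i = a * h $ i + (\<Sum>j\<in>UNIV. b * (y $ i * y $ j) * h $ j)" for i
    by (simp add: radial_matrix_def matrix_vector_mult_def distrib_right sum.distrib
        if_distrib[where f = "\<lambda>x. x * _"] cong: if_cong)
  moreover have "(\<Sum>j\<in>UNIV. b * (y $ i * y $ j) * h $ j) = b * (y \<bullet> h) * y $ i" for i
    by (simp add: inner_vec_def sum_distrib_left sum_distrib_right mult_ac)
  ultimately show ?thesis by (simp add: vec_eq_iff)
qed

text \<open>The set \<open>D\<close> of admissible values of \<open>\<bar>y - z\<bar>\<^sup>2\<close> is a parameter because test functions are smooth in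
  the closed half line \<open>{0..}\<close>, whereas the profile of a given radial solution is only controlled in
  the open half line, away from the centre. One-sided derivatives of the profile at \<open>0\<close> suffice, since
  the squared distance never leaves the half line.\<close>

lemma radial_derivatives:
  fixes u :: "real^'n \<Rightarrow> real"
  assumes V: "open V" "\<And>y. y \<in> V \<Longrightarrow> (norm (y - z))\<^sup>2 \<in> D"
    and u: "\<And>y. y \<in> V \<Longrightarrow> u y = g ((norm (y - z))\<^sup>2)"
    and g: "\<And>s. s \<in> D \<Longrightarrow> (g has_real_derivative g1 s) (at s within D)"
    and g1: "\<And>s. s \<in> D \<Longrightarrow> (g1 has_real_derivative g2 s) (at s within D)"
    and x: "x \<in> V"
  shows "u differentiable (at x)" "gradient u x = (2 * g1 ((norm (x - z))\<^sup>2)) *\<^sub>R (x - z)"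
    and "gradient u differentiable (at x)"
    and "hessian u x = radial_matrix (2 * g1 ((norm (x - z))\<^sup>2)) (4 * g2 ((norm (x - z))\<^sup>2)) (x - z)"
proof -
  let ?s = "\<lambda>y. (norm (y - z))\<^sup>2"
  have s: "(?s has_derivative (\<lambda>h. 2 * ((y - z) \<bullet> h))) (at y)" for y
    unfolding power2_norm_eq_inner
    by (auto intro!: derivative_eq_intros simp: inner_commute)
  have chain: "((\<lambda>y. f (?s y)) has_derivative (\<lambda>h. f1 (?s y) * (2 * ((y - z) \<bullet> h)))) (at y)"
    if y: "y \<in> V" and f: "\<And>s. s \<in> D \<Longrightarrow> (f has_real_derivative f1 s) (at s within D)" for f f1 y
  proof -
    have "((f \<circ> ?s) has_derivative ((\<lambda>d. f1 (?s y) * d) \<circ> (\<lambda>h. 2 * ((y - z) \<bullet> h)))) (at y within V)"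
    proof (rule diff_chain_within)
      show "(?s has_derivative (\<lambda>h. 2 * ((y - z) \<bullet> h))) (at y within V)"
        by (rule has_derivative_at_withinI[OF s])
      have "(f has_derivative (\<lambda>d. f1 (?s y) * d)) (at (?s y) within D)"
        using f[OF V(2)[OF y]] by (simp add: has_field_derivative_def)
      then show "(f has_derivative (\<lambda>d. f1 (?s y) * d)) (at (?s y) within ?s ` V)"
        by (rule has_derivative_subset) (use V(2) in auto)
    qed
    then show ?thesis by (simp only: at_within_open[OF y V(1)] o_def)
  qed
  have du: "(u has_derivative (\<lambda>h. ((2 * g1 (?s y)) *\<^sub>R (y - z)) \<bullet> h)) (at y)" if y: "y \<in> V" for y
  proof -
    have "((\<lambda>y. g (?s y)) has_derivative (\<lambda>h. ((2 * g1 (?s y)) *\<^sub>R (y - z)) \<bullet> h)) (at y)"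
      using chain[OF y g] by (simp add: mult_ac)
    then show ?thesis by (rule has_derivative_transform_within_open[OF _ V(1) y]) (simp add: u)
  qed
  show "u differentiable (at x)" using du[OF x] by (auto simp: differentiable_def)
  have gr: "gradient u y = (2 * g1 (?s y)) *\<^sub>R (y - z)" if "y \<in> V" for y
    using du[OF that] by (rule gradient_unique)
  then show "gradient u x = (2 * g1 (?s x)) *\<^sub>R (x - z)" using x .
  have "((\<lambda>y. (2 * g1 (?s y)) *\<^sub>R (y - z)) has_derivative
      (\<lambda>h. (2 * g1 (?s x)) *\<^sub>R h + (2 * (g2 (?s x) * (2 * ((x - z) \<bullet> h)))) *\<^sub>R (x - z))) (at x)"
    using chain[OF x g1] by (auto intro!: derivative_eq_intros)
  then have "(gradient u has_derivative
      (\<lambda>h. (2 * g1 (?s x)) *\<^sub>R h + (2 * (g2 (?s x) * (2 * ((x - z) \<bullet> h)))) *\<^sub>R (x - z))) (at x)"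
    by (rule has_derivative_transform_within_open[OF _ V(1) x]) (simp add: gr)
  then have dg: "(gradient u has_derivative (\<lambda>h. radial_matrix (2 * g1 (?s x)) (4 * g2 (?s x)) (x - z) *v h)) (at x)"
    by (simp add: radial_matrix_mult mult.assoc)
  then show "gradient u differentiable (at x)" by (auto simp: differentiable_def)
  from dg have "frechet_derivative (gradient u) (at x) = (\<lambda>h. radial_matrix (2 * g1 (?s x)) (4 * g2 (?s x)) (x - z) *v h)"
    by (metis frechet_derivative_at)
  then show "hessian u x = radial_matrix (2 * g1 (?s x)) (4 * g2 (?s x)) (x - z)"
    by (simp add: hessian_def)
qed

lemma radial_C2:
  fixes z :: "real^'n"
  assumes g: "\<And>s. 0 \<le> s \<Longrightarrow> (g has_real_derivative g1 s) (at s within {0..})"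
    and g1: "\<And>s. 0 \<le> s \<Longrightarrow> (g1 has_real_derivative g2 s) (at s within {0..})"
    and g2: "continuous_on {0..} g2"
  shows "C2_on UNIV (\<lambda>x. g ((norm (x - z))\<^sup>2))"
    and "0 < k \<Longrightarrow> k < CARD('n) \<Longrightarrow> Pplus k (hessian (\<lambda>x. g ((norm (x - z))\<^sup>2)) x)
      = 2 * real k * g1 ((norm (x - z))\<^sup>2) + max 0 (4 * (norm (x - z))\<^sup>2 * g2 ((norm (x - z))\<^sup>2))"
proof -
  let ?s = "\<lambda>y. (norm (y - z))\<^sup>2"
  note rad = radial_derivatives[where V = UNIV and D = "{0..}" and u = "\<lambda>x. g (?s x)" and g = g
      and z = z and ?g1.0 = g1 and ?g2.0 = g2]
  have H: "hessian (\<lambda>x. g (?s x)) x = radial_matrix (2 * g1 (?s x)) (4 * g2 (?s x)) (x - z)" for x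
    by (rule rad) (use g g1 in auto)
  have cont: "continuous_on UNIV (\<lambda>x. f (?s x))" if "continuous_on {0..} f" for f :: "real \<Rightarrow> real"
    by (rule continuous_on_compose2[OF that]) (auto intro!: continuous_intros)
  have "continuous_on {0..} g1"
    using g1 by (intro continuous_on_eq_continuous_within[THEN iffD2]) (auto intro: DERIV_continuous)
  note cont = cont[OF this] cont[OF g2]
  have "continuous_on UNIV (\<lambda>x. if i = j then 2 * g1 (?s x) else 0)" for i j :: 'n
    using cont by (cases "i = j") (simp_all add: continuous_on_mult_left)
  with cont have "continuous_on UNIV (hessian (\<lambda>x. g (?s x)))"
    unfolding H[abs_def] radial_matrix_def
    by (intro continuous_on_vec_lambda continuous_on_add) (auto intro!: continuous_intros)
  then show "C2_on UNIV (\<lambda>x. g (?s x))"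
    unfolding C2_on_def using rad(1,3) g g1 by auto
  show "Pplus k (hessian (\<lambda>x. g (?s x)) x) = 2 * real k * g1 (?s x) + max 0 (4 * ?s x * g2 (?s x))"
    if "0 < k" "k < CARD('n)"
    unfolding H radial_matrix_def Pplus_radial[OF that(2,1)] by (simp add: mult_ac)
qed

text \<open>Schwarz's theorem, by the mean value theorem for mixed second differences.\<close>

lemma hessian_symmetric:
  fixes u :: "real^'n \<Rightarrow> real"
  assumes "C2_on UNIV u"
  shows "transpose (hessian u x) = hessian u x"
proof -
  have du: "(u has_derivative (\<lambda>h. gradient u y \<bullet> h)) (at y)" for y
    using assms by (intro has_derivative_gradient) (auto simp: C2_on_def)
  have dg: "(gradient u has_derivative (\<lambda>h. hessian u y *v h)) (at y)" for y
    using assms by (intro has_derivative_hessian) (auto simp: C2_on_def)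
  \<comment> \<open>The mixed second difference of \<open>u\<close> over a small parallelogram is a value of the mixed second
    derivative in either order of differentiation.\<close>
  have mixed: "\<exists>y. norm (y - x) \<le> h * (norm a + norm b) \<and>
      u (x + h *\<^sub>R a + h *\<^sub>R b) - u (x + h *\<^sub>R a) - u (x + h *\<^sub>R b) + u x = h * h * (a \<bullet> (hessian u y *v b))"
    if h: "0 < h" for h :: real and a b :: "real^'n"
  proof -
    define p where "p s = u (x + s *\<^sub>R a + h *\<^sub>R b) - u (x + s *\<^sub>R a)" for s
    have "(p has_real_derivative (gradient u (x + s *\<^sub>R a + h *\<^sub>R b) - gradient u (x + s *\<^sub>R a)) \<bullet> a) (at s)" for s
      unfolding p_def has_field_derivative_def
      by (rule derivative_eq_intros has_derivative_compose[OF _ du] refl)+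
        (auto simp: fun_eq_iff inner_diff_left algebra_simps)
    then obtain s where s: "0 < s" "s < h"
      "p h - p 0 = (h - 0) * ((gradient u (x + s *\<^sub>R a + h *\<^sub>R b) - gradient u (x + s *\<^sub>R a)) \<bullet> a)"
      using MVT2[OF h, of p "\<lambda>s. (gradient u (x + s *\<^sub>R a + h *\<^sub>R b) - gradient u (x + s *\<^sub>R a)) \<bullet> a"] by blast
    define q where "q t = gradient u (x + s *\<^sub>R a + t *\<^sub>R b) \<bullet> a" for t
    have "(q has_real_derivative (hessian u (x + s *\<^sub>R a + t *\<^sub>R b) *v b) \<bullet> a) (at t)" for t
      unfolding q_def has_field_derivative_def
      by (rule derivative_eq_intros has_derivative_compose[OF _ dg] refl)+
        (auto simp: fun_eq_iff matrix_vector_mult_scaleR)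
    then obtain t where t: "0 < t" "t < h"
      "q h - q 0 = (h - 0) * ((hessian u (x + s *\<^sub>R a + t *\<^sub>R b) *v b) \<bullet> a)"
      using MVT2[OF h, of q "\<lambda>t. (hessian u (x + s *\<^sub>R a + t *\<^sub>R b) *v b) \<bullet> a"] by blast
    show ?thesis
    proof (intro exI[of _ "x + s *\<^sub>R a + t *\<^sub>R b"] conjI)
      have "norm (s *\<^sub>R a + t *\<^sub>R b) \<le> s * norm a + t * norm b"
        using s t by (metis abs_of_pos norm_scaleR norm_triangle_ineq)
      also have "\<dots> \<le> h * norm a + h * norm b"
        using s t by (intro add_mono mult_right_mono) auto
      finally show "norm (x + s *\<^sub>R a + t *\<^sub>R b - x) \<le> h * (norm a + norm b)"
        by (simp add: algebra_simps)
      have "p h - p 0 = h * (q h - q 0)"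
        using s(3) by (simp add: q_def inner_diff_left)
      then show "u (x + h *\<^sub>R a + h *\<^sub>R b) - u (x + h *\<^sub>R a) - u (x + h *\<^sub>R b) + u x
          = h * h * (a \<bullet> (hessian u (x + s *\<^sub>R a + t *\<^sub>R b) *v b))"
        using t(3) by (simp add: p_def inner_commute algebra_simps)
    qed
  qed
  have "hessian u x $ i $ j = hessian u x $ j $ i" for i j
  proof (rule ccontr)
    assume ne: "hessian u x $ i $ j \<noteq> hessian u x $ j $ i"
    define e where "e = \<bar>hessian u x $ i $ j - hessian u x $ j $ i\<bar> / 2"
    have e: "0 < e" using ne by (simp add: e_def)
    have "isCont (hessian u) x"
      using assms by (simp add: C2_on_def continuous_on_eq_continuous_at)
    then have "\<forall>\<^sub>F y in nhds x. dist (hessian u y $ m $ l) (hessian u x $ m $ l) < e" for m l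
      using e by (intro tendstoD tendsto_vec_nth) (simp_all add: isCont_def tendsto_at_iff_tendsto_nhds)
    then have "\<forall>\<^sub>F y in nhds x. dist (hessian u y $ i $ j) (hessian u x $ i $ j) < e
        \<and> dist (hessian u y $ j $ i) (hessian u x $ j $ i) < e"
      by (intro eventually_conj)
    then obtain d where d: "0 < d" "\<And>y. dist y x < d \<Longrightarrow> dist (hessian u y $ i $ j) (hessian u x $ i $ j) < e
        \<and> dist (hessian u y $ j $ i) (hessian u x $ j $ i) < e"
      unfolding eventually_nhds_metric by blast
    have h: "0 < d / 4" using d(1) by simp
    let ?a = "axis i 1 :: real^'n" and ?b = "axis j 1 :: real^'n"
    have entry: "axis m 1 \<bullet> (M *v axis l 1) = M $ m $ l" for m l and M :: "real^'n^'n"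
      by (simp add: matrix_vector_mul_component inner_axis inner_axis')
    obtain y where y: "norm (y - x) \<le> d / 4 * (norm ?a + norm ?b)"
      "u (x + (d/4) *\<^sub>R ?a + (d/4) *\<^sub>R ?b) - u (x + (d/4) *\<^sub>R ?a) - u (x + (d/4) *\<^sub>R ?b) + u x
        = d/4 * (d/4) * (hessian u y $ i $ j)"
      using mixed[OF h, of ?a ?b] unfolding entry by (elim exE conjE) (rule that)
    obtain y' where y': "norm (y' - x) \<le> d / 4 * (norm ?b + norm ?a)"
      "u (x + (d/4) *\<^sub>R ?b + (d/4) *\<^sub>R ?a) - u (x + (d/4) *\<^sub>R ?b) - u (x + (d/4) *\<^sub>R ?a) + u x
        = d/4 * (d/4) * (hessian u y' $ j $ i)"
      using mixed[OF h, of ?b ?a] unfolding entry by (elim exE conjE) (rule that)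
    have swap: "x + (d/4) *\<^sub>R ?b + (d/4) *\<^sub>R ?a = x + (d/4) *\<^sub>R ?a + (d/4) *\<^sub>R ?b"
      by (simp add: algebra_simps)
    have "d/4 * (d/4) * (hessian u y $ i $ j) = d/4 * (d/4) * (hessian u y' $ j $ i)"
      unfolding y(2)[symmetric] y'(2)[symmetric] swap by linarith
    moreover have "d/4 * (d/4) \<noteq> 0" using d(1) by simp
    ultimately have eq: "hessian u y $ i $ j = hessian u y' $ j $ i"
      by (metis mult_left_cancel)
    have dist: "dist y x < d" "dist y' x < d" using y(1) y'(1) d(1) by (simp_all add: dist_norm)
    have "\<bar>hessian u y $ i $ j - hessian u x $ i $ j\<bar> < e"
      using d(2)[OF dist(1)] by (simp add: dist_real_def)
    moreover have "\<bar>hessian u y $ i $ j - hessian u x $ j $ i\<bar> < e"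
      using d(2)[OF dist(2)] by (simp add: dist_real_def eq)
    moreover have "2 * e = \<bar>hessian u x $ i $ j - hessian u x $ j $ i\<bar>" by (simp add: e_def)
    ultimately show False by linarith
  qed
  then show ?thesis by (simp add: transpose_def vec_eq_iff)
qed

text \<open>Along a direction with positive second derivative the function would increase strictly.\<close>

lemma hessian_local_max_nonpos:
  fixes u :: "real^'n \<Rightarrow> real"
  assumes C2: "C2_on UNIV u" and max: "\<forall>\<^sub>F y in at x. u y \<le> u x"
  shows "v \<bullet> (hessian u x *v v) \<le> 0"
proof (rule ccontr)
  assume "\<not> ?thesis"
  then have pos: "0 < v \<bullet> (hessian u x *v v)" by simp
  define c where "c t = u (x + t *\<^sub>R v)" for t
  define c1 where "c1 t = gradient u (x + t *\<^sub>R v) \<bullet> v" for t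
  have du: "(u has_derivative (\<lambda>h. gradient u y \<bullet> h)) (at y)" for y
    using C2 by (intro has_derivative_gradient) (auto simp: C2_on_def)
  have dg: "(gradient u has_derivative (\<lambda>h. hessian u y *v h)) (at y)" for y
    using C2 by (intro has_derivative_hessian) (auto simp: C2_on_def)
  have c: "(c has_real_derivative c1 t) (at t)" for t
  proof -
    have "(c has_derivative (\<lambda>h. gradient u (x + t *\<^sub>R v) \<bullet> (h *\<^sub>R v))) (at t)"
      unfolding c_def by (rule has_derivative_compose[OF _ du]) (auto intro!: derivative_eq_intros)
    then show ?thesis
      unfolding c1_def has_field_derivative_def by (simp add: mult.commute[of _ "_ \<bullet> _"])
  qed
  have "(c1 has_real_derivative (hessian u (x + t *\<^sub>R v) *v v) \<bullet> v) (at t)" for t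
    unfolding c1_def has_field_derivative_def
    by (rule derivative_eq_intros has_derivative_compose[OF _ dg] refl)+
      (auto simp: fun_eq_iff matrix_vector_mult_scaleR)
  from this[of 0] obtain d where d: "0 < d" "\<And>h. 0 < h \<Longrightarrow> h < d \<Longrightarrow> c1 0 < c1 h"
    using DERIV_pos_inc_right[of c1 _ 0] pos by (auto simp: inner_commute)
  from max obtain e where e: "0 < e" "\<And>y. dist y x < e \<Longrightarrow> u y \<le> u x"
    unfolding eventually_at by (metis UNIV_I order_refl)
  define r where "r = e / (norm v + 1)"
  have r: "0 < r" using e(1) by (simp add: r_def add_nonneg_pos)
  have cmax: "c t \<le> c 0" if "\<bar>t\<bar> < r" for t
  proof -
    have "\<bar>t\<bar> * norm v \<le> \<bar>t\<bar> * (norm v + 1)" by (simp add: mult_left_mono)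
    also have "\<dots> < e" using that by (simp add: r_def pos_less_divide_eq add_nonneg_pos)
    finally show ?thesis using e(2)[of "x + t *\<^sub>R v"] by (simp add: c_def dist_norm)
  qed
  have "c1 0 = 0"
    using DERIV_local_max[OF c r] cmax by simp
  define h where "h = min d r / 2"
  have h: "0 < h" "h < d" "h < r" using d(1) r by (auto simp: h_def)
  obtain t where t: "0 < t" "t < h" "c h - c 0 = (h - 0) * c1 t"
    using MVT2[OF h(1), of c c1] c by blast
  then have "0 < c h - c 0" using d(2)[of t] h \<open>c1 0 = 0\<close> by simp
  then show False using cmax[of h] h by simp
qed

lemma zero_supersolution:
  assumes "0 < p"
  shows "nonneg_viscosity_supersolution k p UNIV (\<lambda>x :: real^'n. 0)"
  unfolding nonneg_viscosity_supersolution_def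
proof (intro conjI ballI allI impI)
  show "lower_semicontinuous_on UNIV (\<lambda>x :: real^'n. 0)"
    by (simp add: lower_semicontinuous_on_def)
next
  fix x :: "real^'n" and f assume f: "C2_on UNIV f \<and> local_min_on UNIV (\<lambda>y. 0 - f y) x"
  then have "\<forall>\<^sub>F y in at x. f y \<le> f x" by (simp add: local_min_on_def)
  then have "Pplus k (hessian f x) \<le> 0"
    using f by (intro Pplus_nonpos hessian_symmetric hessian_local_max_nonpos) auto
  then show "Pplus k (hessian f x) + 0 powr p \<le> 0" by simp
qed simp

section \<open>An explicit supersolution\<close>

text \<open>With \<open>a = 1 / (p - 1)\<close> one has \<open>a p = a + 1\<close>, so both terms of the inequality for the profile
  \<open>C (1 + s)\<^bsup>-a\<^esup>\<close> decay like \<open>(1 + s)\<^bsup>-a-1\<^esup>\<close>. The coefficient \<open>a (2 k - 4 (a + 1))\<close> of the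
  operator is positive exactly above the exponent \<open>k / (k - 2)\<close>; the choice of \<open>C\<close> balances it with \<open>C\<^bsup>p-1\<^esup>\<close>.\<close>

lemma exists_positive_supersolution:
  assumes k: "2 < k" "k < CARD('n)" and p: "real k / (real k - 2) < p"
  shows "\<exists>u :: real^'n \<Rightarrow> real. (\<forall>x. 0 < u x) \<and> classical_supersolution k p UNIV u"
proof -
  have "real k < p * (real k - 2)" using p k by (simp add: pos_divide_less_eq)
  then have p2: "2 < (p - 1) * (real k - 2)" by (simp add: algebra_simps)
  have "1 < real k / (real k - 2)" using k by simp
  then have p1: "1 < p" using p by linarith
  define a where "a = 1 / (p - 1)"
  have a: "0 < a" "a * p = a + 1" using p1 by (simp_all add: a_def field_simps)
  have "2 * a < real k - 2" using p2 p1 by (simp add: a_def field_simps)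
  then have c: "0 < a * (2 * real k - 4 * (a + 1))" (is "0 < ?c") using a by simp
  define C where "C = ?c powr a"
  have C: "0 < C" using c unfolding C_def by (metis less_irrefl powr_gt_zero)
  have Cp: "C powr p = C * ?c"
  proof -
    have "C powr p = ?c powr (a + 1)" unfolding C_def powr_powr a(2) ..
    then show ?thesis using c unfolding C_def powr_add by simp
  qed
  define g where "g s = C * (1 + s) powr (-a)" for s
  define g1 where "g1 s = - (C * a * (1 + s) powr (-a - 1))" for s
  define g2 where "g2 s = C * a * (a + 1) * (1 + s) powr (-a - 2)" for s
  have dg: "(g has_real_derivative g1 s) (at s within {0..})" if "0 \<le> s" for s
    unfolding g_def g1_def using that by (auto intro!: derivative_eq_intros)
  have dg1: "(g1 has_real_derivative g2 s) (at s within {0..})" if "0 \<le> s" for s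
    unfolding g1_def g2_def using that by (auto intro!: derivative_eq_intros simp: algebra_simps)
  have cg2: "continuous_on {0..} g2" unfolding g2_def by (auto intro!: continuous_intros)
  let ?u = "\<lambda>x :: real^'n. g ((norm (x - 0))\<^sup>2)"
  note rad = radial_C2[OF dg dg1 cg2, where z = "0 :: real^'n"]
  have "Pplus k (hessian ?u x) + ?u x powr p \<le> 0" for x
  proof -
    define s where "s = (norm (x - 0))\<^sup>2"
    have s: "0 \<le> s" by (simp add: s_def)
    define E where "E = (1 + s) powr (-a - 1)"
    have E: "0 < E" "(1 + s) powr (-a - 2) * (1 + s) = E"
    proof -
      have "E = (1 + s) powr ((-a - 2) + 1)"
        unfolding E_def by (rule arg_cong[where f = "(powr) (1 + s)"]) simp
      then show "(1 + s) powr (-a - 2) * (1 + s) = E" using s unfolding powr_add by simp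
    qed (use s in \<open>simp add: E_def\<close>)
    have "s * (1 + s) powr (-a - 2) \<le> (1 + s) powr (-a - 2) * (1 + s)"
      using s by (simp add: algebra_simps)
    then have sE: "s * (1 + s) powr (-a - 2) \<le> E" by (simp add: E)
    have "4 * s * g2 s = 4 * C * a * (a + 1) * (s * (1 + s) powr (-a - 2))" by (simp add: g2_def)
    also have "\<dots> \<le> 4 * C * a * (a + 1) * E" using sE C a by (intro mult_left_mono) auto
    finally have "4 * s * g2 s \<le> 4 * C * a * (a + 1) * E" .
    moreover have "0 \<le> 4 * s * g2 s" using s C a by (simp add: g2_def)
    ultimately have "Pplus k (hessian ?u x) \<le> 2 * real k * g1 s + 4 * C * a * (a + 1) * E"
      using rad(2)[of k x] k unfolding s_def[symmetric] by simp
    also have "\<dots> = - (C * ?c * E)" by (simp add: g1_def E_def algebra_simps)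
    also have "C * ?c * E = g s powr p"
      using C s a(2) unfolding g_def powr_mult powr_powr Cp E_def by (simp add: Cp[symmetric] powr_mult powr_powr)
    finally show ?thesis by (simp add: s_def)
  qed
  moreover have "0 < ?u x" for x
    unfolding g_def using C by (intro mult_pos_pos) (simp_all add: add_nonneg_eq_0_iff)
  ultimately show ?thesis
    using rad(1) unfolding classical_supersolution_def by (intro exI[of _ ?u]) auto
qed

section \<open>The Pohozaev function and radial solutions below the Sobolev exponent\<close>

text \<open>The function whose derivative along solutions of the radial equation has a constant sign, the
  sign of the difference between the Sobolev exponent and \<open>p\<close>.\<close>

definition pohozaev :: "nat \<Rightarrow> real \<Rightarrow> (real \<Rightarrow> real) \<Rightarrow> (real \<Rightarrow> real) \<Rightarrow> real \<Rightarrow> real" where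
  "pohozaev k p f f1 r = r ^ k * ((f1 r)\<^sup>2 / 2 + f r powr (p + 1) / (p + 1))
     + (real k - 2) / 2 * r ^ (k - 1) * f r * f1 r"

text \<open>The terms with \<open>f1\<close> cancel: the factor \<open>(k - 2) / 2\<close> in the definition is chosen for that purpose.\<close>

lemma pohozaev_derivative:
  assumes k: "2 < k" and p: "0 < p" and r: "0 < r" and pos: "0 < f r"
    and f: "(f has_real_derivative f1 r) (at r)"
    and f1: "(f1 has_real_derivative f2) (at r)"
    and ode: "f2 + (real k - 1) * f1 r / r + f r powr p = 0"
  shows "(pohozaev k p f f1 has_real_derivative
      (real k / (p + 1) - (real k - 2) / 2) * r ^ (k - 1) * f r powr (p + 1)) (at r)"
proof -
  obtain m where m: "k = m + 2" using k by (metis add.commute le_Suc_ex less_imp_le)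
  define F where "F = f r powr p"
  have Fp: "f r powr (p + 1) = f r * F" using pos by (simp add: powr_add F_def)
  have f2: "f2 = - (real k - 1) * f1 r / r - F" using ode unfolding F_def by (simp only: mult_minus_left minus_divide_left[symmetric])
  have "((\<lambda>r. f r powr (p + 1)) has_real_derivative (p + 1) * F * f1 r) (at r)"
    using pos f by (auto intro!: derivative_eq_intros simp: F_def)
  from DERIV_cdivide[OF this, of "p + 1"] p
  have Fd: "((\<lambda>r. f r powr (p + 1) / (p + 1)) has_real_derivative F * f1 r) (at r)" by simp
  have sq: "((\<lambda>r. (f1 r)\<^sup>2 / 2) has_real_derivative f1 r * f2) (at r)"
    using f1 by (auto intro!: derivative_eq_intros)
  have pw: "((\<lambda>r. r ^ k) has_real_derivative real k * r ^ (m + 1)) (at r)"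
    "((\<lambda>r. r ^ (k - 1)) has_real_derivative (real m + 1) * r ^ m) (at r)"
    using DERIV_pow[of k r UNIV] DERIV_pow[of "k - 1" r UNIV] by (simp_all add: m add.commute)
  let ?D = "real k * r ^ (m + 1) * ((f1 r)\<^sup>2 / 2 + f r powr (p + 1) / (p + 1)) + (f1 r * f2 + F * f1 r) * r ^ k
    + (((real k - 2) / 2 * ((real m + 1) * r ^ m) * f r + f1 r * ((real k - 2) / 2 * r ^ (k - 1))) * f1 r
      + f2 * ((real k - 2) / 2 * r ^ (k - 1) * f r))"
  have "(pohozaev k p f f1 has_real_derivative ?D) (at r)"
    unfolding pohozaev_def[abs_def]
    by (intro DERIV_add DERIV_mult DERIV_cmult pw Fd sq f f1)
  moreover have "?D = (real k / (p + 1) - (real k - 2) / 2) * r ^ (k - 1) * f r powr (p + 1)"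
  proof -
    define R where "R = r ^ m"
    have R: "r ^ (m + 1) = r * R" "r ^ k = r * r * R" "r ^ (k - 1) = r * R" "r ^ m = R"
      by (simp_all add: R_def m)
    have k: "real k = real m + 2" by (simp add: m)
    define y ci where "y = f1 r / r" and "ci = inverse (p + 1)"
    have y: "f1 r = r * y" using r by (simp add: y_def)
    have y2: "f2 = - ((real m + 1) * y) - F" 
    proof -
      have "real k - 1 = real m + 1" by (simp add: k)
      then show ?thesis unfolding f2 y_def by (simp only: minus_mult_left[symmetric] minus_divide_left[symmetric] times_divide_eq_right)
    qed
    have ci: "x / (p + 1) = x * ci" for x by (simp add: ci_def divide_inverse)
    show ?thesis unfolding Fp R k y y2 ci by (simp add: field_simps power2_eq_square)
  qed
  ultimately show ?thesis by simp
qed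

text \<open>The Pohozaev function \<open>P\<close> vanishes at \<open>0\<close> and increases strictly below the Sobolev exponent. The
  equation gives \<open>f\<^bsup>p-1\<^esup> \<le> c / r\<^sup>2\<close>, and monotonicity of \<open>q = f' / r\<close> bounds \<open>f'\<close> by \<open>f / r\<close>;
  hence \<open>P\<close> is at most of the order \<open>r\<^bsup>k-2\<^esup> f\<^sup>2\<close>, which tends to \<open>0\<close>, again below the Sobolev
  exponent.\<close>

lemma emden_no_positive_entire_solution:
  fixes f f1 f2 :: "real \<Rightarrow> real"
  assumes k: "2 < k" and p: "1 < p" "p < (real k + 2) / (real k - 2)"
    and f: "\<And>r. (f has_real_derivative f1 r) (at r)"
    and f1: "\<And>r. (f1 has_real_derivative f2 r) (at r)"
    and cont: "continuous_on {0<..} f2"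
    and pos: "\<And>r. 0 < f r"
    and eq: "\<And>r. 0 < r \<Longrightarrow> real k * (f1 r / r) + max 0 (f2 r - f1 r / r) + f r powr p = 0"
  shows False
proof -
  have k0: "0 < real k" using k by simp
  define q where "q r = f1 r / r" for r
  define d where "d r = f2 r - f1 r / r" for r
  have q_le: "real k * q r \<le> - (f r powr p)" if "0 < r" for r
    using eq[OF that] by (simp add: q_def)
  have q_neg: "q r < 0" if "0 < r" for r
  proof -
    have "real k * q r < 0" using q_le[OF that] pos[of r] by (smt (verit) powr_gt_zero)
    then show ?thesis using k0 by (simp add: mult_less_0_iff)
  qed
  have f1_neg: "f1 r < 0" if "0 < r" for r
    using q_neg[OF that] that by (simp add: q_def divide_less_0_iff)
  have dq: "(q has_real_derivative d r / r) (at r)" if "0 < r" for r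
    unfolding q_def d_def using that f1[of r]
    by (auto intro!: derivative_eq_intros simp: field_simps power2_eq_square)
  \<comment> \<open>Wherever the tangential eigenvalues were the largest, the equation would read
    \<open>k q = - f\<^sup>p\<close>, an increasing function of the radius, while \<open>q' = d / r < 0\<close>.\<close>
  have d_nonneg: "0 \<le> d r" if r: "0 < r" for r
  proof (rule ccontr)
    assume neg: "\<not> 0 \<le> d r"
    have "isCont f2 r" using cont r by (simp add: continuous_on_eq_continuous_at)
    then have "isCont d r"
      unfolding d_def using r f1[of r] by (intro continuous_intros) (auto intro: DERIV_isCont)
    then have "\<forall>\<^sub>F t in nhds r. d t < 0"
      using neg by (intro order_tendstoD(2)[where y = "d r"]) (simp_all add: isCont_def tendsto_at_iff_tendsto_nhds)
    moreover have "\<forall>\<^sub>F t in nhds r. 0 < t"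
      using r eventually_nhds_in_open[of "{0<..}" r] by simp
    ultimately have "\<forall>\<^sub>F t in nhds r. q t = - (f t powr p) / real k"
    proof eventually_elim
      case (elim t)
      then show ?case using eq[of t] k0 by (simp add: q_def d_def field_simps)
    qed
    moreover have "((\<lambda>t. - (f t powr p) / real k) has_real_derivative - (p * f r powr (p - 1) * f1 r) / real k) (at r)"
      using pos[of r] f[of r] k0 by (auto intro!: derivative_eq_intros)
    ultimately have "(q has_real_derivative - (p * f r powr (p - 1) * f1 r) / real k) (at r)"
      by (rule DERIV_cong_ev[THEN iffD2, OF refl _ refl])
    then have "d r / r = - (p * f r powr (p - 1) * f1 r) / real k"
      using dq[OF r] DERIV_unique by blast
    moreover have "d r / r < 0" using neg r by (simp add: divide_less_0_iff)
    moreover have "0 < - (p * f r powr (p - 1) * f1 r) / real k"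
      using p pos[of r] f1_neg[OF r] k0
      by (intro divide_pos_pos) (auto simp: mult_less_0_iff)
    ultimately show False by linarith
  qed
  have ode: "f2 r + (real k - 1) * f1 r / r + f r powr p = 0" if "0 < r" for r
    using eq[OF that] d_nonneg[OF that] by (simp add: d_def algebra_simps diff_divide_distrib)
  define c where "c = 2 * real k / (p - 1)"
  have c: "0 < c" using p k0 by (simp add: c_def)
  \<comment> \<open>Integration of \<open>f' / r \<le> - f\<^sup>p / k\<close>.\<close>
  have decay: "f r powr (p - 1) \<le> c / r\<^sup>2" if r: "0 < r" for r
  proof -
    define w where "w t = f t powr (1 - p) - t\<^sup>2 / c" for t
    have "(w has_real_derivative (1 - p) * f t powr (-p) * f1 t - 2 * t / c) (at t)" for t
      unfolding w_def using f[of t] pos[of t] c by (auto intro!: derivative_eq_intros)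
    then obtain t where t: "0 < t" "t < r" "w r - w 0 = (r - 0) * ((1 - p) * f t powr (-p) * f1 t - 2 * t / c)"
      using MVT2[OF r, of w "\<lambda>t. (1 - p) * f t powr (-p) * f1 t - 2 * t / c"] by blast
    have "f t powr (-p) * f1 t = t * (f t powr (-p) * q t)" using t by (simp add: q_def)
    also have "\<dots> \<le> t * (f t powr (-p) * (- (f t powr p) / real k))"
      using t q_le[OF t(1)] k0
      by (intro mult_left_mono) (simp_all only: pos_le_divide_eq mult.commute powr_ge_zero less_imp_le)
    also have "f t powr (-p) * (- (f t powr p) / real k) = - 1 / real k"
      using pos[of t] by (simp add: powr_minus)
    finally have "(p - 1) * (f t powr (-p) * f1 t) \<le> (p - 1) * (t * (- 1 / real k))"
      using p by (intro mult_left_mono) auto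
    then have "0 \<le> (1 - p) * f t powr (-p) * f1 t - 2 * t / c"
      using k0 p by (simp add: c_def field_simps)
    then have "w 0 \<le> w r" using t r by (smt (verit) mult_nonneg_nonneg)
    moreover have "0 < w 0" using pos[of 0] by (simp add: w_def)
    ultimately have "0 < w r" by linarith
    then have "r\<^sup>2 / c \<le> f r powr (1 - p)" by (simp add: w_def)
    moreover have "f r powr (1 - p) = inverse (f r powr (p - 1))"
      by (metis minus_diff_eq powr_minus)
    moreover have "0 < r\<^sup>2 / c" using r c by simp
    moreover have "0 < f r powr (p - 1)" using pos[of r] by simp
    ultimately show ?thesis using r c by (simp add: field_simps)
  qed
  \<comment> \<open>On \<open>[r, 2 r]\<close> the derivative of \<open>f\<close> is at most \<open>q(2 r) t\<close>, and \<open>f\<close> cannot fall below \<open>0\<close>.\<close>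
  have slope: "- q (2 * r) * (3/2) * r\<^sup>2 \<le> f r" if r: "0 < r" for r
  proof -
    have mono: "q s \<le> q t" if "0 < s" "s \<le> t" for s t
    proof (rule DERIV_nonneg_imp_nondecreasing[OF that(2)])
      fix r assume "s \<le> r" "r \<le> t"
      then have "0 < r" using that by simp
      then show "\<exists>y. (q has_real_derivative y) (at r) \<and> 0 \<le> y"
        using dq d_nonneg by (intro exI[of _ "d r / r"]) simp
    qed
    define h where "h t = f t - q (2 * r) * t\<^sup>2 / 2" for t
    have "h (2 * r) \<le> h r"
    proof (rule DERIV_nonpos_imp_nonincreasing[of r "2 * r" h])
      fix t assume t: "r \<le> t" "t \<le> 2 * r"
      have "(h has_real_derivative f1 t - q (2 * r) * t) (at t)"
        unfolding h_def using f[of t] by (auto intro!: derivative_eq_intros)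
      moreover have "f1 t - q (2 * r) * t = t * (q t - q (2 * r))"
        using t r by (simp add: q_def field_simps)
      moreover have "\<dots> \<le> 0" using mono[of t "2 * r"] t r by (intro mult_nonneg_nonpos) auto
      ultimately show "\<exists>y. (h has_real_derivative y) (at t) \<and> y \<le> 0" by metis
    qed (use r in simp)
    then show ?thesis using pos[of "2 * r"] by (simp add: h_def power2_eq_square algebra_simps)
  qed
  define P where "P = pohozaev k p f f1"
  have contP: "continuous_on A P" for A
  proof -
    have c: "continuous_on A f" "continuous_on A f1"
      using f f1 by (auto intro!: continuous_at_imp_continuous_on DERIV_isCont)
    have "f x \<noteq> 0" for x using pos[of x] by simp
    then show ?thesis
      unfolding P_def pohozaev_def[abs_def] using p by (intro continuous_intros c ballI) simp_all
  qed
  have crit: "0 < real k / (p + 1) - (real k - 2) / 2"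
    using k p by (simp add: field_simps)
  have Pinc: "P s < P t" if "0 \<le> s" "s < t" for s t
  proof (rule DERIV_pos_imp_increasing_open[OF that(2)])
    fix r assume r: "s < r" "r < t"
    then have "0 < r" using that by simp
    then have "(P has_real_derivative (real k / (p + 1) - (real k - 2) / 2) * r ^ (k - 1) * f r powr (p + 1)) (at r)"
      unfolding P_def using k p pos f f1 ode by (intro pohozaev_derivative) auto
    moreover have "0 < (real k / (p + 1) - (real k - 2) / 2) * r ^ (k - 1) * f r powr (p + 1)"
      using crit \<open>0 < r\<close> pos[of r] by (intro mult_pos_pos) simp_all
    ultimately show "\<exists>y. (P has_real_derivative y) (at r) \<and> 0 < y" by blast
  qed (rule contP)
  have "P 0 = 0" unfolding P_def pohozaev_def using k by (simp add: power_0_left)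
  then have P1: "0 < P 1" using Pinc[of 0 1] by simp
  define e where "e = 4 / (p - 1) - (real k - 2)"
  have e: "0 < e" using p k by (simp add: e_def field_simps)
  define K where "K = 2 ^ k * (8/9 + c / (p + 1))"
  have K: "0 < K" using c p by (simp add: K_def add_pos_pos)
  have upper: "P (2 * r) \<le> K * c powr (2 / (p - 1)) * r powr (-e)" if r: "0 < r" for r
  proof -
    have "f (2 * r) \<le> f r"
    proof (rule DERIV_nonpos_imp_nonincreasing[of r "2 * r" f])
      fix t assume "r \<le> t" "t \<le> 2 * r"
      then show "\<exists>y. (f has_real_derivative y) (at t) \<and> y \<le> 0"
        using r f[of t] f1_neg[of t] by (intro exI[of _ "f1 t"]) simp
    qed (use r in simp)
    then have "f (2 * r) powr (p + 1) \<le> f r powr (p + 1)"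
      using pos[of "2 * r"] p by (intro powr_mono2) auto
    also have "\<dots> = (f r)\<^sup>2 * f r powr (p - 1)"
      using pos[of r] powr_add[of "f r" 2 "p - 1"] by (simp add: powr_numeral add.commute)
    also have "\<dots> \<le> (f r)\<^sup>2 * (c / r\<^sup>2)" using decay[OF r] by (intro mult_left_mono) auto
    finally have A: "f (2 * r) powr (p + 1) \<le> (f r)\<^sup>2 * (c / r\<^sup>2)" .
    have "- q (2 * r) \<le> 2 / 3 * f r / r\<^sup>2" using slope[OF r] r by (simp add: field_simps)
    then have "(- q (2 * r))\<^sup>2 \<le> (2 / 3 * f r / r\<^sup>2)\<^sup>2"
      using q_neg[of "2 * r"] r by (intro power_mono) auto
    then have "(2 * r)\<^sup>2 * (q (2 * r))\<^sup>2 \<le> (2 * r)\<^sup>2 * (2 / 3 * f r / r\<^sup>2)\<^sup>2"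
      by (intro mult_left_mono) auto
    moreover have "(f1 (2 * r))\<^sup>2 = (2 * r)\<^sup>2 * (q (2 * r))\<^sup>2" using r by (simp add: q_def power_divide)
    moreover have "(2 * r)\<^sup>2 * (2 / 3 * f r / r\<^sup>2)\<^sup>2 = 16 / 9 * ((f r)\<^sup>2 / r\<^sup>2)"
      using r by (simp add: power_mult_distrib power_divide field_simps power2_eq_square)
    ultimately have B: "(f1 (2 * r))\<^sup>2 \<le> 16 / 9 * ((f r)\<^sup>2 / r\<^sup>2)" by linarith
    have "(real k - 2) / 2 * (2 * r) ^ (k - 1) * f (2 * r) * f1 (2 * r) \<le> 0"
      using k r pos[of "2 * r"] f1_neg[of "2 * r"] by (intro mult_nonneg_nonpos) auto
    then have "P (2 * r) \<le> (2 * r) ^ k * ((f1 (2 * r))\<^sup>2 / 2 + f (2 * r) powr (p + 1) / (p + 1))"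
      unfolding P_def pohozaev_def by linarith
    also have "\<dots> \<le> (2 * r) ^ k * ((16 / 9 * ((f r)\<^sup>2 / r\<^sup>2)) / 2 + ((f r)\<^sup>2 * (c / r\<^sup>2)) / (p + 1))"
      using A B r p by (intro mult_left_mono add_mono divide_right_mono) auto
    also have "\<dots> = K * (r ^ k / r\<^sup>2 * (f r)\<^sup>2)"
      by (simp add: K_def power_mult_distrib algebra_simps add_divide_distrib)
    also have "r ^ k / r\<^sup>2 = r powr (real k - 2)"
      using r by (simp add: powr_diff powr_realpow powr_numeral)
    finally have main: "P (2 * r) \<le> K * (r powr (real k - 2) * (f r)\<^sup>2)" .
    have "(f r)\<^sup>2 \<le> (c / r\<^sup>2) powr (2 / (p - 1))"
    proof -
      have "(f r)\<^sup>2 = (f r powr (p - 1)) powr (2 / (p - 1))"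
      proof -
        have "(p - 1) * (2 / (p - 1)) = 2" using p by (simp add: field_simps)
        then show ?thesis using pos[of r] by (simp only: powr_powr powr_numeral less_imp_le)
      qed
      also have "\<dots> \<le> (c / r\<^sup>2) powr (2 / (p - 1))"
        using decay[OF r] p by (intro powr_mono2) auto
      finally show ?thesis .
    qed
    also have "(c / r\<^sup>2) powr (2 / (p - 1)) = c powr (2 / (p - 1)) * r powr (- (4 / (p - 1)))"
    proof -
      have "(r\<^sup>2) powr (2 / (p - 1)) = (r powr 2) powr (2 / (p - 1))" using r by (simp add: powr_numeral)
      also have "\<dots> = r powr (4 / (p - 1))" unfolding powr_powr by simp
      finally show ?thesis using c r by (simp add: powr_divide powr_minus_divide)
    qed
    finally have "(f r)\<^sup>2 \<le> c powr (2 / (p - 1)) * r powr (- (4 / (p - 1)))" .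
    then have "K * (r powr (real k - 2) * (f r)\<^sup>2)
        \<le> K * (r powr (real k - 2) * (c powr (2 / (p - 1)) * r powr (- (4 / (p - 1)))))"
      using K by (intro mult_left_mono) auto
    also have "\<dots> = K * c powr (2 / (p - 1)) * r powr (-e)"
    proof -
      have "r powr (-e) = r powr (real k - 2) * r powr (- (4 / (p - 1)))"
        by (simp add: e_def flip: powr_add)
      then show ?thesis by simp
    qed
    finally show ?thesis using main by linarith
  qed
  have "((\<lambda>r. K * c powr (2 / (p - 1)) * r powr (-e)) \<longlongrightarrow> K * c powr (2 / (p - 1)) * 0) at_top"
    using e by (intro tendsto_mult tendsto_const tendsto_neg_powr filterlim_ident) auto
  then have "\<forall>\<^sub>F r in at_top. K * c powr (2 / (p - 1)) * r powr (-e) < P 1"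
    using P1 by (intro order_tendstoD(2)) auto
  moreover have "\<forall>\<^sub>F r in at_top. (1::real) < r" by (rule eventually_gt_at_top)
  ultimately have "\<forall>\<^sub>F r :: real in at_top. False"
  proof eventually_elim
    case (elim r)
    then show ?case using upper[of r] Pinc[of 1 "2 * r"] by simp
  qed
  then show False by simp
qed

text \<open>The profile is studied along a ray. In terms of \<open>f(r)\<close> the multiple eigenvalue is \<open>f' / r\<close> and the
  radial one is \<open>f''\<close>.\<close>

lemma no_positive_radial_solution:
  fixes u :: "real^'n \<Rightarrow> real"
  assumes k: "2 < k" "k < CARD('n)"
    and p: "real k / (real k - 2) < p" "p < (real k + 2) / (real k - 2)"
    and u: "radial u" "\<And>x. 0 < u x" "classical_solution k p UNIV u"
  shows False
proof -
  obtain m :: 'n where True by simp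
  define e :: "real^'n" where "e = axis m 1"
  have e: "norm e = 1" by (simp add: e_def)
  define f where "f r = u (r *\<^sub>R e)" for r
  define f1 where "f1 r = gradient u (r *\<^sub>R e) \<bullet> e" for r
  define f2 where "f2 r = (hessian u (r *\<^sub>R e) *v e) \<bullet> e" for r
  have C2: "C2_on UNIV u" and sol: "\<And>x. Pplus k (hessian u x) + u x powr p = 0"
    using u(3) by (auto simp: classical_solution_def)
  have du: "(u has_derivative (\<lambda>h. gradient u y \<bullet> h)) (at y)" for y
    using C2 by (intro has_derivative_gradient) (auto simp: C2_on_def)
  have dg: "(gradient u has_derivative (\<lambda>h. hessian u y *v h)) (at y)" for y
    using C2 by (intro has_derivative_hessian) (auto simp: C2_on_def)
  have f: "(f has_real_derivative f1 r) (at r)" for r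
  proof -
    have "(f has_derivative (\<lambda>h. gradient u (r *\<^sub>R e) \<bullet> (h *\<^sub>R e))) (at r)"
      unfolding f_def by (rule has_derivative_compose[OF _ du]) (auto intro!: derivative_eq_intros)
    then show ?thesis
      unfolding f1_def has_field_derivative_def by (simp add: mult.commute[of _ "_ \<bullet> _"])
  qed
  have f1: "(f1 has_real_derivative f2 r) (at r)" for r
    unfolding f1_def f2_def has_field_derivative_def
    by (rule derivative_eq_intros has_derivative_compose[OF _ dg] refl)+
      (auto simp: fun_eq_iff matrix_vector_mult_scaleR)
  have cont: "continuous_on {0<..} f2"
  proof -
    have "continuous_on UNIV (hessian u)" using C2 by (simp add: C2_on_def)
    moreover have "continuous_on {0<..} (\<lambda>r. r *\<^sub>R e)" by (intro continuous_intros)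
    ultimately have "continuous_on {0<..} (\<lambda>r. hessian u (r *\<^sub>R e))"
      by (rule continuous_on_compose2) simp
    then show ?thesis
      unfolding f2_def matrix_vector_mult_def inner_vec_def
      by (auto intro!: continuous_intros)
  qed
  have rep: "u x = f (sqrt ((norm (x - 0))\<^sup>2))" for x
    using u(1) e unfolding f_def radial_def by (metis abs_norm_cancel diff_zero mult.right_neutral norm_scaleR real_sqrt_abs)
  define g1 where "g1 s = f1 (sqrt s) / (2 * sqrt s)" for s
  define g2 where "g2 s = (f2 (sqrt s) - f1 (sqrt s) / sqrt s) / (4 * s)" for s
  have g: "((\<lambda>s. f (sqrt s)) has_real_derivative g1 s) (at s within {0<..})" if "s \<in> {0<..}" for s
  proof -
    have s: "0 < s" using that by simp
    have "((\<lambda>s. f (sqrt s)) has_real_derivative f1 (sqrt s) * (inverse (sqrt s) / 2)) (at s)"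
      by (intro DERIV_chain2[OF f] DERIV_real_sqrt s)
    moreover have "f1 (sqrt s) * (inverse (sqrt s) / 2) = g1 s"
      using s by (simp add: g1_def field_simps)
    ultimately show ?thesis by (metis has_field_derivative_at_within)
  qed
  have g1: "(g1 has_real_derivative g2 s) (at s within {0<..})" if "s \<in> {0<..}" for s
  proof -
    have s: "0 < s" using that by simp
    have "(g1 has_real_derivative (f2 (sqrt s) * (inverse (sqrt s) / 2) * (2 * sqrt s)
        - f1 (sqrt s) * (2 * (inverse (sqrt s) / 2))) / ((2 * sqrt s) * (2 * sqrt s))) (at s)"
      unfolding g1_def using s
      by (intro DERIV_divide DERIV_chain2[OF f1] DERIV_cmult DERIV_real_sqrt) auto
    moreover have "(f2 (sqrt s) * (inverse (sqrt s) / 2) * (2 * sqrt s)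
        - f1 (sqrt s) * (2 * (inverse (sqrt s) / 2))) / ((2 * sqrt s) * (2 * sqrt s)) = g2 s"
      using s by (simp add: g2_def field_simps)
    ultimately show ?thesis by (metis has_field_derivative_at_within)
  qed
  have eq: "real k * (f1 r / r) + max 0 (f2 r - f1 r / r) + f r powr p = 0" if r: "0 < r" for r
  proof -
    have x: "r *\<^sub>R e \<in> - {0}" using r e by auto
    have s: "(norm (r *\<^sub>R e - 0))\<^sup>2 = r\<^sup>2" using e by simp
    have "hessian u (r *\<^sub>R e) = radial_matrix (2 * g1 (r\<^sup>2)) (4 * g2 (r\<^sup>2)) (r *\<^sub>R e - 0)"
      using radial_derivatives(4)[where V = "- {0}" and D = "{0<..}" and z = 0 and g = "\<lambda>s. f (sqrt s)"
          and u = u, OF _ _ rep g g1 x] unfolding s by auto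
    then have "Pplus k (hessian u (r *\<^sub>R e)) = real k * (2 * g1 (r\<^sup>2)) + max 0 (4 * g2 (r\<^sup>2) * r\<^sup>2)"
      unfolding radial_matrix_def using k s by (simp only: Pplus_radial)
    moreover have "2 * g1 (r\<^sup>2) = f1 r / r" "4 * g2 (r\<^sup>2) * r\<^sup>2 = f2 r - f1 r / r"
      using r by (simp_all add: g1_def g2_def)
    ultimately show ?thesis using sol[of "r *\<^sub>R e"] by (simp add: f_def)
  qed
  have "1 < real k / (real k - 2)" using k by simp
  then have "1 < p" using p by linarith
  then show False
    using emden_no_positive_entire_solution[OF k(1) _ p(2) f f1 cont _ eq] u(2) by (simp add: f_def)
qed

section \<open>Entire solutions from the Sobolev exponent on\<close>

text \<open>The radial equation \<open>4 s g'' + 2 k g' + G = 0\<close> is equivalent to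
  \<open>4 (s\<^bsup>k/2\<^esup> g')' = - s\<^bsup>k/2-1\<^esup> G\<close>. Integrating from \<open>0\<close> to \<open>t\<close> and rescaling the integration
  variable to \<open>t \<sigma>\<^sup>2\<close> expresses \<open>g'(t)\<close> by the following average of \<open>G\<close>, in which the singularity at
  \<open>0\<close> has disappeared and all powers are integral.\<close>

definition emden_slope :: "nat \<Rightarrow> (real \<Rightarrow> real) \<Rightarrow> real \<Rightarrow> real" where
  "emden_slope k G t = - (1/2) * integral {0..1} (\<lambda>\<sigma>. \<sigma> ^ (k - 1) * G (t * \<sigma>\<^sup>2))"

lemma emden_slope_integrand_continuous:
  fixes G :: "real \<Rightarrow> real"
  assumes G: "continuous_on U G" and U: "\<And>s c. s \<in> U \<Longrightarrow> 0 \<le> c \<Longrightarrow> c \<le> 1 \<Longrightarrow> s * c \<in> U"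
  shows "continuous_on (U \<times> {0..1}) (\<lambda>(t, \<sigma>). \<sigma> ^ m * G (t * \<sigma>\<^sup>2))"
    and "t \<in> U \<Longrightarrow> continuous_on {0..1} (\<lambda>\<sigma>. \<sigma> ^ m * G (t * \<sigma>\<^sup>2))"
proof -
  have "continuous_on (U \<times> {0..1}) (\<lambda>x. G (fst x * (snd x)\<^sup>2))"
  proof (rule continuous_on_compose2[OF G])
    show "continuous_on (U \<times> {0..1}) (\<lambda>x. fst x * (snd x)\<^sup>2)" by (intro continuous_intros)
    show "(\<lambda>x. fst x * (snd x)\<^sup>2) ` (U \<times> {0..1}) \<subseteq> U"
      using U by (auto simp: power_le_one)
  qed
  then show *: "continuous_on (U \<times> {0..1}) (\<lambda>(t, \<sigma>). \<sigma> ^ m * G (t * \<sigma>\<^sup>2))"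
    unfolding split_beta by (intro continuous_intros)
  show "continuous_on {0..1} (\<lambda>\<sigma>. \<sigma> ^ m * G (t * \<sigma>\<^sup>2))" if "t \<in> U"
  proof -
    have c: "continuous_on {0..1} (\<lambda>\<sigma>. (t, \<sigma>))" by (intro continuous_intros)
    have "(\<lambda>\<sigma>. (t, \<sigma>)) ` {0..1} \<subseteq> U \<times> {0..1}" using that by auto
    from continuous_on_compose2[OF * c this] show ?thesis by simp
  qed
qed

lemma continuous_on_emden_slope:
  fixes G :: "real \<Rightarrow> real"
  assumes G: "continuous_on U G" and U: "\<And>s c. s \<in> U \<Longrightarrow> 0 \<le> c \<Longrightarrow> c \<le> 1 \<Longrightarrow> s * c \<in> U"
  shows "continuous_on U (emden_slope k G)"
proof -
  have "continuous_on U (\<lambda>t. integral (cbox 0 1) (\<lambda>\<sigma>. \<sigma> ^ (k - 1) * G (t * \<sigma>\<^sup>2)))"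
    by (rule integral_continuous_on_param)
      (use emden_slope_integrand_continuous(1)[OF G U, of "k - 1"] in \<open>simp add: cbox_interval\<close>)
  then show ?thesis
    unfolding emden_slope_def[abs_def] by (intro continuous_intros) (simp add: cbox_interval)
qed

lemma integral_has_derivative_half_line:
  fixes w :: "real \<Rightarrow> real"
  assumes w: "continuous_on {0..} w" and s: "0 \<le> s"
  shows "((\<lambda>s. integral {0..s} w) has_real_derivative w s) (at s within {0..})"
proof -
  have "((\<lambda>s. integral {0..s} w) has_real_derivative w s) (at s within {0..s + 1})"
    by (rule integral_has_real_derivative) (use s in \<open>auto intro: continuous_on_subset[OF w]\<close>)
  moreover have "at s within {0..s + 1} = at s within {0..}"
    by (rule at_within_nhd[of s "{..<s + 1}"]) auto
  ultimately show ?thesis by simp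
qed

text \<open>Banach's fixed point theorem. Carrying the weight \<open>exp (- \<Lambda> \<bar>s\<bar>)\<close> makes the integral operator
  a contraction on the whole line at once, in place of a local solution that has to be continued:
  \<open>\<Lambda> \<ge> L\<close> gives the contraction, and \<open>\<Lambda> \<ge> 1\<close> keeps the image bounded. The unknown is \<open>h\<close> with
  \<open>g(s) = exp (\<Lambda> \<bar>s\<bar>) h(s)\<close>; negative arguments are present only because bounded continuous
  functions are defined on a whole type.\<close>

lemma emden_integral_equation:
  fixes F :: "real \<Rightarrow> real"
  assumes lip: "\<And>x y. \<bar>F x - F y\<bar> \<le> L * \<bar>x - y\<bar>" and L: "0 \<le> L" and bound: "\<And>x. \<bar>F x\<bar> \<le> B"
  obtains g where "continuous_on {0..} g"
    "\<And>s. 0 \<le> s \<Longrightarrow> g s = 1 + integral {0..s} (emden_slope k (\<lambda>t. F (g t)))"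
proof -
  define \<Lambda> where "\<Lambda> = L + 1"
  have \<Lambda>: "1 \<le> \<Lambda>" "0 < \<Lambda>" "L \<le> \<Lambda>" using L by (simp_all add: \<Lambda>_def)
  have B: "0 \<le> B" using bound[of 0] by linarith
  have contF: "continuous_on UNIV F"
  proof (rule continuous_onI)
    fix x e :: real assume e: "0 < e"
    show "\<exists>d>0. \<forall>x'\<in>UNIV. dist x' x < d \<longrightarrow> dist (F x') (F x) \<le> e"
    proof (intro exI[of _ "e / \<Lambda>"] conjI ballI impI)
      fix x' assume "dist x' x < e / \<Lambda>"
      then have "\<Lambda> * \<bar>x' - x\<bar> \<le> e" using \<Lambda> by (simp add: dist_real_def field_simps)
      moreover have "L * \<bar>x' - x\<bar> \<le> \<Lambda> * \<bar>x' - x\<bar>" using \<Lambda> by (intro mult_right_mono) auto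
      ultimately show "dist (F x') (F x) \<le> e" using lip[of x' x] by (simp add: dist_real_def)
    qed (use e \<Lambda> in simp)
  qed
  define E where "E h t = exp (\<Lambda> * \<bar>t\<bar>) * apply_bcontfun h t" for h :: "real \<Rightarrow>\<^sub>C real" and t
  define W where "W h = emden_slope k (\<lambda>t. F (E h t))" for h
  define Op where "Op h s = exp (- (\<Lambda> * \<bar>s\<bar>)) * (1 + integral {0..\<bar>s\<bar>} (W h))" for h s
  have contE: "continuous_on UNIV (\<lambda>t. F (E h t))" for h
    unfolding E_def by (rule continuous_on_compose2[OF contF]) (auto intro!: continuous_intros)
  have contW: "continuous_on A (W h)" for h A
    unfolding W_def by (rule continuous_on_subset[OF continuous_on_emden_slope[OF contE]]) auto
  have ci: "continuous_on {0..1} (\<lambda>\<sigma>. \<sigma> ^ (k - 1) * F (E h (t * \<sigma>\<^sup>2)))" for h t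
    by (rule emden_slope_integrand_continuous(2)[OF contE]) auto
  have Wbound: "\<bar>W h t\<bar> \<le> B" for h t
  proof -
    have "norm (integral {0..1} (\<lambda>\<sigma>. \<sigma> ^ (k - 1) * F (E h (t * \<sigma>\<^sup>2)))) \<le> B * (1 - 0)"
    proof (rule integral_bound[OF _ ci])
      fix \<sigma> :: real assume "\<sigma> \<in> {0..1}"
      then have "\<bar>\<sigma> ^ (k - 1)\<bar> * \<bar>F (E h (t * \<sigma>\<^sup>2))\<bar> \<le> 1 * B"
        by (intro mult_mono bound) (auto intro!: power_le_one)
      then show "norm (\<sigma> ^ (k - 1) * F (E h (t * \<sigma>\<^sup>2))) \<le> B" by (simp add: abs_mult)
    qed simp
    then show ?thesis using B by (simp add: W_def emden_slope_def)
  qed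
  have Opb: "Op h \<in> bcontfun" for h
  proof (rule bcontfun_normI)
    have "continuous_on {0..} (\<lambda>s. integral {0..s} (W h))"
      using integral_has_derivative_half_line[OF contW]
      by (auto simp: continuous_on_eq_continuous_within intro: DERIV_continuous)
    then have "continuous_on UNIV (\<lambda>s. integral {0..\<bar>s\<bar>} (W h))"
      by (rule continuous_on_compose2) (auto intro!: continuous_intros)
    then show "continuous_on UNIV (Op h)"
      unfolding Op_def by (intro continuous_intros)
    fix s :: real
    have "norm (integral {0..\<bar>s\<bar>} (W h)) \<le> B * (\<bar>s\<bar> - 0)"
      using Wbound by (intro integral_bound contW) auto
    then have "\<bar>1 + integral {0..\<bar>s\<bar>} (W h)\<bar> \<le> 1 + B * \<bar>s\<bar>" by simp
    also have "\<dots> \<le> (1 + B) * exp (\<Lambda> * \<bar>s\<bar>)"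
    proof -
      have "1 * \<bar>s\<bar> \<le> \<Lambda> * \<bar>s\<bar>" using \<Lambda> by (intro mult_right_mono) auto
      then have "1 + \<bar>s\<bar> \<le> exp (\<Lambda> * \<bar>s\<bar>)" using exp_ge_add_one_self[of "\<Lambda> * \<bar>s\<bar>"] by linarith
      then have "(1 + B) * (1 + \<bar>s\<bar>) \<le> (1 + B) * exp (\<Lambda> * \<bar>s\<bar>)" using B by (intro mult_left_mono) auto
      then show ?thesis using B by (simp add: algebra_simps)
    qed
    finally have "exp (- (\<Lambda> * \<bar>s\<bar>)) * \<bar>1 + integral {0..\<bar>s\<bar>} (W h)\<bar> \<le> exp (- (\<Lambda> * \<bar>s\<bar>)) * ((1 + B) * exp (\<Lambda> * \<bar>s\<bar>))"
      by (intro mult_left_mono) auto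
    also have "\<dots> = 1 + B" by (simp add: exp_minus field_simps)
    finally show "norm (Op h s) \<le> 1 + B" by (simp add: Op_def abs_mult)
  qed
  have contraction: "dist (Bcontfun (Op h)) (Bcontfun (Op h')) \<le> 1/2 * dist h h'" for h h'
  proof (rule dist_bound)
    fix s :: real
    let ?d = "dist h h'"
    have Wdiff: "\<bar>W h t - W h' t\<bar> \<le> (L / 2 * ?d) * exp (\<Lambda> * t)" if t: "0 \<le> t" for t
    proof -
      have "W h t - W h' t = - (1/2) * integral {0..1} (\<lambda>\<sigma>. \<sigma> ^ (k - 1) * F (E h (t * \<sigma>\<^sup>2)) - \<sigma> ^ (k - 1) * F (E h' (t * \<sigma>\<^sup>2)))"
        unfolding W_def emden_slope_def
        by (subst integral_diff, (rule integrable_continuous_real[OF ci])+) (simp only: right_diff_distrib)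
      moreover have "norm (integral {0..1} (\<lambda>\<sigma>. \<sigma> ^ (k - 1) * F (E h (t * \<sigma>\<^sup>2)) - \<sigma> ^ (k - 1) * F (E h' (t * \<sigma>\<^sup>2))))
          \<le> (L * (exp (\<Lambda> * t) * ?d)) * (1 - 0)"
      proof (rule integral_bound)
        show "continuous_on {0..1} (\<lambda>\<sigma>. \<sigma> ^ (k - 1) * F (E h (t * \<sigma>\<^sup>2)) - \<sigma> ^ (k - 1) * F (E h' (t * \<sigma>\<^sup>2)))"
          by (intro continuous_intros ci)
        fix \<sigma> :: real assume \<sigma>: "\<sigma> \<in> {0..1}"
        then have t': "0 \<le> t * \<sigma>\<^sup>2" "t * \<sigma>\<^sup>2 \<le> t" using t by (auto intro!: mult_left_le power_le_one)
        have "\<bar>E h (t * \<sigma>\<^sup>2) - E h' (t * \<sigma>\<^sup>2)\<bar> = exp (\<Lambda> * (t * \<sigma>\<^sup>2)) * dist (apply_bcontfun h (t * \<sigma>\<^sup>2)) (apply_bcontfun h' (t * \<sigma>\<^sup>2))"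
          using t' by (simp add: E_def dist_real_def abs_mult flip: right_diff_distrib)
        also have "\<dots> \<le> exp (\<Lambda> * t) * ?d"
          using t' \<Lambda> by (intro mult_mono dist_bounded) auto
        finally have "L * \<bar>E h (t * \<sigma>\<^sup>2) - E h' (t * \<sigma>\<^sup>2)\<bar> \<le> L * (exp (\<Lambda> * t) * ?d)"
          using L by (intro mult_left_mono)
        then have "\<bar>F (E h (t * \<sigma>\<^sup>2)) - F (E h' (t * \<sigma>\<^sup>2))\<bar> \<le> L * (exp (\<Lambda> * t) * ?d)"
          using lip[of "E h (t * \<sigma>\<^sup>2)" "E h' (t * \<sigma>\<^sup>2)"] by linarith
        then have "\<bar>\<sigma> ^ (k - 1)\<bar> * \<bar>F (E h (t * \<sigma>\<^sup>2)) - F (E h' (t * \<sigma>\<^sup>2))\<bar> \<le> 1 * (L * (exp (\<Lambda> * t) * ?d))"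
          using \<sigma> by (intro mult_mono) (auto intro!: power_le_one)
        then show "norm (\<sigma> ^ (k - 1) * F (E h (t * \<sigma>\<^sup>2)) - \<sigma> ^ (k - 1) * F (E h' (t * \<sigma>\<^sup>2))) \<le> L * (exp (\<Lambda> * t) * ?d)"
          by (simp add: abs_mult flip: right_diff_distrib)
      qed simp
      ultimately show ?thesis by (simp add: abs_mult mult_ac)
    qed
    have exp_int: "((\<lambda>t. (L / 2 * ?d) * exp (\<Lambda> * t)) has_integral
        (L / 2 * ?d) * (exp (\<Lambda> * \<bar>s\<bar>) / \<Lambda>) - (L / 2 * ?d) * (exp (\<Lambda> * 0) / \<Lambda>)) {0..\<bar>s\<bar>}"
      using \<Lambda> by (intro fundamental_theorem_of_calculus)
        (auto intro!: derivative_eq_intros simp flip: has_real_derivative_iff_has_vector_derivative)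
    have "integral {0..\<bar>s\<bar>} (W h) - integral {0..\<bar>s\<bar>} (W h') = integral {0..\<bar>s\<bar>} (\<lambda>t. W h t - W h' t)"
      by (subst integral_diff) (auto intro!: integrable_continuous_real contW)
    moreover have "norm (integral {0..\<bar>s\<bar>} (\<lambda>t. W h t - W h' t)) \<le> integral {0..\<bar>s\<bar>} (\<lambda>t. (L / 2 * ?d) * exp (\<Lambda> * t))"
      using exp_int Wdiff
      by (intro integral_norm_bound_integral) (auto intro!: integrable_continuous_real continuous_intros contW)
    moreover have "\<dots> = (L / 2 * ?d) * (exp (\<Lambda> * \<bar>s\<bar>) / \<Lambda>) - (L / 2 * ?d) * (exp (\<Lambda> * 0) / \<Lambda>)"
      by (rule integral_unique[OF exp_int])
    moreover have "\<dots> \<le> (L / 2 * ?d) * (exp (\<Lambda> * \<bar>s\<bar>) / \<Lambda>)" using L \<Lambda> by simp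
    moreover have "\<dots> \<le> 1/2 * ?d * exp (\<Lambda> * \<bar>s\<bar>)"
    proof -
      have "L / \<Lambda> \<le> 1" using \<Lambda> by simp
      then have "(L / \<Lambda>) * (?d / 2 * exp (\<Lambda> * \<bar>s\<bar>)) \<le> 1 * (?d / 2 * exp (\<Lambda> * \<bar>s\<bar>))"
        by (intro mult_right_mono) auto
      then show ?thesis by simp
    qed
    ultimately have "\<bar>integral {0..\<bar>s\<bar>} (W h) - integral {0..\<bar>s\<bar>} (W h')\<bar> \<le> 1/2 * ?d * exp (\<Lambda> * \<bar>s\<bar>)"
      by simp
    then have "exp (- (\<Lambda> * \<bar>s\<bar>)) * \<bar>integral {0..\<bar>s\<bar>} (W h) - integral {0..\<bar>s\<bar>} (W h')\<bar>
        \<le> exp (- (\<Lambda> * \<bar>s\<bar>)) * (1/2 * ?d * exp (\<Lambda> * \<bar>s\<bar>))"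
      by (intro mult_left_mono) auto
    also have "\<dots> = 1/2 * ?d" by (simp add: exp_minus field_simps)
    finally show "dist (apply_bcontfun (Bcontfun (Op h)) s) (apply_bcontfun (Bcontfun (Op h')) s) \<le> 1/2 * ?d"
      by (simp add: Bcontfun_inverse[OF Opb] Op_def dist_real_def abs_mult flip: right_diff_distrib)
  qed
  obtain h where "Bcontfun (Op h) = h"
    using banach_fix_type[of "1/2" "\<lambda>h. Bcontfun (Op h)"] contraction by auto
  then have h: "apply_bcontfun h = Op h" by (metis Bcontfun_inverse Opb)
  show ?thesis
  proof (rule that[of "E h"])
    show "continuous_on {0..} (E h)" unfolding E_def by (intro continuous_intros) auto
    show "E h s = 1 + integral {0..s} (emden_slope k (\<lambda>t. F (E h t)))" if "0 \<le> s" for s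
      using that unfolding E_def[of h s] h by (simp add: Op_def W_def exp_minus)
  qed
qed

lemma DERIV_compose_within:
  assumes "(f has_real_derivative D) (at (g x) within T)"
    and "(g has_real_derivative E) (at x within S)" and "g ` S \<subseteq> T"
  shows "((\<lambda>x. f (g x)) has_real_derivative D * E) (at x within S)"
  using DERIV_image_chain[OF DERIV_subset[OF assms(1,3)] assms(2)] by (simp add: o_def)

text \<open>Differentiating the average under the integral sign shows that \<open>v' = w\<close> is an average of the
  derivative \<open>p g\<^bsup>p-1\<^esup> v \<le> 0\<close> of \<open>g\<^sup>p\<close> with a negative factor, hence \<open>w \<ge> 0\<close>: convexity in the variable
  \<open>s\<close> is automatic.\<close>

lemma emden_regularity:
  fixes g v :: "real \<Rightarrow> real"
  assumes U: "U \<subseteq> {0..}" "convex U" "\<And>s c. s \<in> U \<Longrightarrow> 0 \<le> c \<Longrightarrow> c \<le> 1 \<Longrightarrow> s * c \<in> U"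
    and k: "0 < k" and p: "0 < p"
    and pos: "\<And>s. s \<in> U \<Longrightarrow> 0 < g s"
    and dg: "\<And>s. s \<in> U \<Longrightarrow> (g has_real_derivative v s) (at s within U)"
    and v: "\<And>s. s \<in> U \<Longrightarrow> v s = emden_slope k (\<lambda>t. g t powr p) s"
    and v_nonpos: "\<And>s. s \<in> U \<Longrightarrow> v s \<le> 0"
  shows "\<exists>w. continuous_on U w \<and> (\<forall>s\<in>U. (v has_real_derivative w s) (at s within U)
    \<and> 0 \<le> w s \<and> 4 * s * w s + 2 * real k * v s + g s powr p = 0)"
proof -
  define G where "G s = g s powr p" for s
  define G1 where "G1 s = p * g s powr (p - 1) * v s" for s
  have dG: "(G has_real_derivative G1 s) (at s within U)" if "s \<in> U" for s
    unfolding G_def G1_def using dg[OF that] pos[OF that]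
    by (auto intro!: derivative_eq_intros)
  have contg: "continuous_on U g" and contG: "continuous_on U G"
    using dg dG by (auto simp: continuous_on_eq_continuous_within intro: DERIV_continuous)
  have contv: "continuous_on U v"
    using continuous_on_emden_slope[OF contG U(3), of k] v
    by (simp add: G_def[abs_def] cong: continuous_on_cong)
  have contG1: "continuous_on U G1"
    unfolding G1_def using pos by (intro continuous_intros contg contv) force
  define w where "w s = - (1/2) * integral {0..1} (\<lambda>\<sigma>. \<sigma> ^ (k + 1) * G1 (s * \<sigma>\<^sup>2))" for s
  have ci: "continuous_on {0..1} (\<lambda>\<sigma>. \<sigma> ^ m * H (s * \<sigma>\<^sup>2))"
    if "continuous_on U H" "s \<in> U" for m s and H :: "real \<Rightarrow> real"
    by (rule emden_slope_integrand_continuous(2)[OF that(1) _ that(2)]) (rule U(3))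
  have w': "w s = - (1/2) * integral (cbox 0 1) (\<lambda>\<sigma>. \<sigma> ^ (k - 1) * (G1 (s * \<sigma>\<^sup>2) * \<sigma>\<^sup>2))" for s
  proof -
    obtain m where "k = Suc m" using k by (cases k) auto
    then show ?thesis by (simp add: w_def cbox_interval power2_eq_square mult_ac)
  qed
  have dv: "(v has_real_derivative w s) (at s within U)" if s: "s \<in> U" for s
  proof -
    have "((\<lambda>s. integral (cbox 0 1) (\<lambda>\<sigma>. \<sigma> ^ (k - 1) * G (s * \<sigma>\<^sup>2))) has_real_derivative
        integral (cbox 0 1) (\<lambda>\<sigma>. \<sigma> ^ (k - 1) * (G1 (s * \<sigma>\<^sup>2) * \<sigma>\<^sup>2))) (at s within U)"
    proof (rule leibniz_rule_field_derivative[OF _ _ _ s U(2)])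
      fix x t :: real assume xt: "x \<in> U" "t \<in> cbox 0 1"
      then have "x * t\<^sup>2 \<in> U" by (intro U(3)) (auto simp: power_le_one)
      moreover have "(\<lambda>x. x * t\<^sup>2) ` U \<subseteq> U" using xt(2) by (auto intro!: U(3) simp: power_le_one)
      ultimately have "((\<lambda>x. G (x * t\<^sup>2)) has_real_derivative G1 (x * t\<^sup>2) * t\<^sup>2) (at x within U)"
        by (intro DERIV_compose_within[OF dG]) (auto intro!: derivative_eq_intros)
      then show "((\<lambda>x. t ^ (k - 1) * G (x * t\<^sup>2)) has_real_derivative t ^ (k - 1) * (G1 (x * t\<^sup>2) * t\<^sup>2)) (at x within U)"
        by (rule DERIV_cmult)
    next
      show "(\<lambda>\<sigma>. \<sigma> ^ (k - 1) * G (x * \<sigma>\<^sup>2)) integrable_on cbox 0 1" if "x \<in> U" for x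
        unfolding cbox_interval by (intro integrable_continuous_real ci contG that)
    next
      have "continuous_on (U \<times> {0..1}) (\<lambda>(x, t). t ^ (k - 1) * G1 (x * t\<^sup>2))"
        by (rule emden_slope_integrand_continuous(1)[OF contG1 U(3)])
      then have "continuous_on (U \<times> {0..1}) (\<lambda>y. (case y of (x, t) \<Rightarrow> t ^ (k - 1) * G1 (x * t\<^sup>2)) * (snd y)\<^sup>2)"
        by (intro continuous_intros)
      then show "continuous_on (U \<times> cbox 0 1) (\<lambda>(x, t). t ^ (k - 1) * (G1 (x * t\<^sup>2) * t\<^sup>2))"
        by (simp add: split_beta cbox_interval mult.assoc)
    qed
    from DERIV_cmult[OF this, of "- (1/2)"]
    have "(emden_slope k G has_real_derivative w s) (at s within U)"
      unfolding w' emden_slope_def[abs_def] by (simp add: cbox_interval)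
    then show ?thesis
      by (rule has_field_derivative_transform_within[OF _ zero_less_one s]) (simp add: v G_def[abs_def])
  qed
  have contw: "continuous_on U w"
  proof -
    have "continuous_on U (emden_slope (k + 2) G1)"
      by (rule continuous_on_emden_slope[OF contG1 U(3)])
    then show ?thesis by (simp add: emden_slope_def[abs_def] w_def[abs_def])
  qed
  have w_nonneg: "0 \<le> w s" if s: "s \<in> U" for s
  proof -
    have "integral {0..1} (\<lambda>\<sigma>. \<sigma> ^ (k + 1) * G1 (s * \<sigma>\<^sup>2)) \<le> integral {0..1} (\<lambda>\<sigma> :: real. 0 :: real)"
    proof (rule integral_le)
      show "(\<lambda>\<sigma>. \<sigma> ^ (k + 1) * G1 (s * \<sigma>\<^sup>2)) integrable_on {0..1}"
        by (intro integrable_continuous_real ci contG1 s)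
      fix \<sigma> :: real assume \<sigma>: "\<sigma> \<in> {0..1}"
      then have "s * \<sigma>\<^sup>2 \<in> U" using s by (intro U(3)) (auto simp: power_le_one)
      then show "\<sigma> ^ (k + 1) * G1 (s * \<sigma>\<^sup>2) \<le> 0"
        using \<sigma> p v_nonpos unfolding G1_def by (intro mult_nonneg_nonpos) auto
    qed (rule integrable_0)
    then show ?thesis by (simp add: w_def)
  qed
  \<comment> \<open>Integrating \<open>(\<sigma>\<^sup>k G(s \<sigma>\<^sup>2))'\<close> over the unit interval turns the averages into the differential equation.\<close>
  have ode: "4 * s * w s + 2 * real k * v s + g s powr p = 0" if s: "s \<in> U" for s
  proof -
    let ?i = "\<lambda>\<sigma>. real k * (\<sigma> ^ (k - 1) * G (s * \<sigma>\<^sup>2)) + 2 * s * (\<sigma> ^ (k + 1) * G1 (s * \<sigma>\<^sup>2))"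
    have "(?i has_integral (1 ^ k * G (s * 1\<^sup>2) - 0 ^ k * G (s * 0\<^sup>2))) {0..1}"
    proof (rule fundamental_theorem_of_calculus)
      fix \<sigma> :: real assume \<sigma>: "\<sigma> \<in> {0..1}"
      have "s * \<sigma>\<^sup>2 \<in> U" using s \<sigma> by (intro U(3)) (auto simp: power_le_one)
      moreover have "(\<lambda>\<sigma>. s * \<sigma>\<^sup>2) ` {0..1} \<subseteq> U" using s by (auto intro!: U(3) simp: power_le_one)
      ultimately have "((\<lambda>\<sigma>. G (s * \<sigma>\<^sup>2)) has_real_derivative G1 (s * \<sigma>\<^sup>2) * (s * (2 * \<sigma>))) (at \<sigma> within {0..1})"
        by (intro DERIV_compose_within[OF dG]) (auto intro!: derivative_eq_intros)
      from DERIV_mult[OF DERIV_pow this, of k]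
      have "((\<lambda>\<sigma>. \<sigma> ^ k * G (s * \<sigma>\<^sup>2)) has_real_derivative
          real k * \<sigma> ^ (k - 1) * G (s * \<sigma>\<^sup>2) + G1 (s * \<sigma>\<^sup>2) * (s * (2 * \<sigma>)) * \<sigma> ^ k) (at \<sigma> within {0..1})"
        by simp
      then show "((\<lambda>\<sigma>. \<sigma> ^ k * G (s * \<sigma>\<^sup>2)) has_vector_derivative ?i \<sigma>) (at \<sigma> within {0..1})"
        unfolding has_real_derivative_iff_has_vector_derivative[symmetric] by (simp add: mult_ac)
    qed simp
    then have "integral {0..1} ?i = G s" using k by (simp add: integral_unique power_0_left)
    moreover have "integral {0..1} ?i = real k * integral {0..1} (\<lambda>\<sigma>. \<sigma> ^ (k - 1) * G (s * \<sigma>\<^sup>2))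
        + 2 * s * integral {0..1} (\<lambda>\<sigma>. \<sigma> ^ (k + 1) * G1 (s * \<sigma>\<^sup>2))"
      by (subst integral_add)
        (simp_all only: integral_mult_right integrable_on_mult_right integrable_continuous_real[OF ci[OF contG s]]
          integrable_continuous_real[OF ci[OF contG1 s]])
    moreover have "integral {0..1} (\<lambda>\<sigma>. \<sigma> ^ (k - 1) * G (s * \<sigma>\<^sup>2)) = -2 * v s"
      unfolding v[OF s] emden_slope_def G_def by simp
    moreover have "integral {0..1} (\<lambda>\<sigma>. \<sigma> ^ (k + 1) * G1 (s * \<sigma>\<^sup>2)) = -2 * w s"
      unfolding w_def by simp
    ultimately show ?thesis by (simp add: G_def algebra_simps)
  qed
  show ?thesis using contw dv w_nonneg ode by blast
qed

lemma clamped_powr_lipschitz: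
  fixes p :: real
  assumes p: "1 \<le> p"
  shows "\<bar>(min 1 (max 0 x)) powr p - (min 1 (max 0 y)) powr p\<bar> \<le> p * \<bar>x - y\<bar>"
proof -
  have main: "b powr p - a powr p \<le> p * (b - a)" if ab: "0 \<le> a" "a < b" "b \<le> 1" for a b :: real
  proof -
    have "continuous_on {a..b} (\<lambda>x. x powr p)"
      using ab p by (intro continuous_on_powr' continuous_intros) auto
    moreover have d: "((\<lambda>x. x powr p) has_real_derivative p * x powr (p - 1)) (at x)" if "a < x" for x
      using that ab by (auto intro!: derivative_eq_intros)
    ultimately obtain l z where z: "a < z" "z < b" "((\<lambda>x. x powr p) has_real_derivative l) (at z)"
      "b powr p - a powr p = (b - a) * l"
      using MVT[of a b "\<lambda>x. x powr p"] ab(2) unfolding real_differentiable_def by blast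
    have "l = p * z powr (p - 1)" using DERIV_unique[OF z(3) d[OF z(1)]] .
    moreover have "z powr (p - 1) \<le> 1" using z ab p by (intro powr_le1) auto
    ultimately have "l \<le> p" using p by (simp add: mult_left_le)
    then show ?thesis using z(4) ab by (simp add: mult_left_mono mult.commute)
  qed
  have mono: "a powr p \<le> b powr p" if "0 \<le> a" "a \<le> b" for a b :: real
    using that p by (intro powr_mono2) auto
  define c where "c z = min 1 (max 0 z)" for z :: real
  have c: "0 \<le> c z" "c z \<le> 1" for z by (auto simp: c_def)
  have "\<bar>c x powr p - c y powr p\<bar> \<le> p * \<bar>c x - c y\<bar>"
  proof (cases "c x" "c y" rule: linorder_cases)
    case less
    then show ?thesis using main[of "c x" "c y"] mono[of "c x" "c y"] c by simp
  next
    case greater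
    then show ?thesis using main[of "c y" "c x"] mono[of "c y" "c x"] c by simp
  qed simp
  also have "\<dots> \<le> p * \<bar>x - y\<bar>"
    using p by (intro mult_left_mono) (auto simp: c_def)
  finally show ?thesis by (simp add: c_def)
qed

text \<open>The integral equation is solved for the nonlinearity truncated to \<open>[0, 1]\<close>, which is Lipschitz. The
  upper truncation is never active because \<open>g\<close> decreases from \<open>1\<close>. At a first zero \<open>R\<close> the Pohozaev
  function would be a positive multiple of \<open>v(R)\<^sup>2\<close>, but it is nonincreasing and starts from \<open>0\<close>; so
  \<open>v(R) = 0\<close>, which is impossible for an average of a function that is positive on \<open>[0, R)\<close>.\<close>

lemma emden_regular_solution:
  assumes k: "2 < k" and p: "(real k + 2) / (real k - 2) \<le> p"
  shows "\<exists>g v w :: real \<Rightarrow> real.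
    (\<forall>s\<ge>0. 0 < g s \<and> (g has_real_derivative v s) (at s within {0..})
      \<and> (v has_real_derivative w s) (at s within {0..}) \<and> 0 \<le> w s
      \<and> 4 * s * w s + 2 * real k * v s + g s powr p = 0)
    \<and> continuous_on {0..} w"
proof -
  have "1 < (real k + 2) / (real k - 2)" using k by simp
  then have p1: "1 < p" using p by linarith
  define F where "F x = (min 1 (max 0 x)) powr p" for x :: real
  have F01: "0 \<le> F x" "F x \<le> 1" for x
    unfolding F_def using p1 by (auto intro!: powr_le1)
  obtain g where contg: "continuous_on {0..} g"
    and g: "\<And>s. 0 \<le> s \<Longrightarrow> g s = 1 + integral {0..s} (emden_slope k (\<lambda>t. F (g t)))"
  proof (rule emden_integral_equation[of F p 1 k])
    show "\<bar>F x - F y\<bar> \<le> p * \<bar>x - y\<bar>" for x y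
      using clamped_powr_lipschitz[of p] p1 unfolding F_def by simp
    show "\<bar>F x\<bar> \<le> 1" for x using F01[of x] by simp
  qed (use p1 that in auto)
  define v where "v = emden_slope k (\<lambda>t. F (g t))"
  have contF: "continuous_on {0..} (\<lambda>t. F (g t))"
    unfolding F_def using p1 by (intro continuous_on_powr' continuous_intros contg) auto
  have contv: "continuous_on {0..} v"
    unfolding v_def by (rule continuous_on_emden_slope[OF contF]) auto
  have dg: "(g has_real_derivative v s) (at s within {0..})" if "0 \<le> s" for s
  proof -
    have "((\<lambda>s. 1 + integral {0..s} v) has_real_derivative 0 + v s) (at s within {0..})"
      by (intro DERIV_add DERIV_const integral_has_derivative_half_line contv that)
    then show ?thesis
      using has_field_derivative_transform_within[OF _ zero_less_one, of _ _ s "{0..}" g] that g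
      by (simp add: v_def)
  qed
  have ci: "continuous_on {0..1} (\<lambda>\<sigma>. \<sigma> ^ (k - 1) * F (g (s * \<sigma>\<^sup>2)))" if "0 \<le> s" for s
    by (rule emden_slope_integrand_continuous(2)[OF contF]) (use that in auto)
  have v_nonpos: "v s \<le> 0" if "0 \<le> s" for s
  proof -
    have "0 \<le> integral {0..1} (\<lambda>\<sigma>. \<sigma> ^ (k - 1) * F (g (s * \<sigma>\<^sup>2)))"
      using F01 by (intro integral_nonneg integrable_continuous_real ci[OF that]) simp
    then show ?thesis unfolding v_def emden_slope_def by linarith
  qed
  have g_le: "g s \<le> 1" if "0 \<le> s" for s
  proof -
    have "integral {0..s} v \<le> integral {0..s} (\<lambda>_. 0)"
      using v_nonpos
      by (intro integral_le integrable_continuous_real continuous_on_subset[OF contv]) auto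
    then show ?thesis using g[OF that] by (simp add: v_def)
  qed
  have g0: "g 0 = 1" using g[of 0] by simp
  have v_eq: "v s = emden_slope k (\<lambda>t. g t powr p) s" if s: "0 \<le> s" and pos: "\<And>t. 0 \<le> t \<Longrightarrow> t \<le> s \<Longrightarrow> 0 < g t" for s
  proof -
    have "F (g (s * \<sigma>\<^sup>2)) = g (s * \<sigma>\<^sup>2) powr p" if "\<sigma> \<in> {0..1}" for \<sigma> :: real
    proof -
      have "0 \<le> s * \<sigma>\<^sup>2" "s * \<sigma>\<^sup>2 \<le> s" using that s by (auto intro!: mult_left_le simp: power_le_one)
      then show ?thesis using pos g_le by (simp add: F_def less_imp_le min_absorb2 max_absorb2)
    qed
    then show ?thesis unfolding v_def emden_slope_def by (auto intro!: integral_cong)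
  qed
  have pos: "0 < g s" if "0 \<le> s" for s
  proof (rule ccontr)
    assume "\<not> 0 < g s"
    define Z where "Z = {t \<in> {0..s}. g t \<le> 0}"
    have "compact Z"
      unfolding Z_def compact_eq_bounded_closed
      using continuous_on_closed_Collect_le[of "{0..s}" g "\<lambda>_. 0"] continuous_on_subset[OF contg, of "{0..s}"]
      by (auto intro!: bounded_subset[OF bounded_closed_interval])
    moreover have "s \<in> Z" using \<open>\<not> 0 < g s\<close> that by (simp add: Z_def)
    ultimately obtain R where R: "R \<in> Z" "\<And>t. t \<in> Z \<Longrightarrow> R \<le> t"
      using compact_attains_inf[of Z] by blast
    have R0: "0 < R" using R(1) g0 by (cases "R = 0") (auto simp: Z_def)
    have posR: "0 < g t" if "0 \<le> t" "t < R" for t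
      using R(1) R(2)[of t] that by (force simp: Z_def)
    define U where "U = {0..<R}"
    have gR: "g R = 0"
    proof (rule antisym)
      show "g R \<le> 0" using R(1) by (simp add: Z_def)
      show "0 \<le> g R"
      proof (rule ccontr)
        assume "\<not> 0 \<le> g R"
        then obtain t where "0 \<le> t" "t \<le> R" "g t = 0"
          using IVT2'[of g R 0 0] g0 R0 continuous_on_subset[OF contg, of "{0..R}"] by auto
        then show False using posR[of t] \<open>\<not> 0 \<le> g R\<close> by (cases "t = R") auto
      qed
    qed
    have "\<exists>w. continuous_on U w \<and> (\<forall>s\<in>U. (v has_real_derivative w s) (at s within U)
        \<and> 0 \<le> w s \<and> 4 * s * w s + 2 * real k * v s + g s powr p = 0)"
    proof (rule emden_regularity)
      show "s * c \<in> U" if "s \<in> U" "0 \<le> c" "c \<le> 1" for s c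
        using that mult_left_le[of c s] by (auto simp: U_def)
      show "v s = emden_slope k (\<lambda>t. g t powr p) s" if "s \<in> U" for s
        using that posR by (intro v_eq) (auto simp: U_def)
      show "(g has_real_derivative v s) (at s within U)" if "s \<in> U" for s
        by (rule DERIV_subset[OF dg]) (use that in \<open>auto simp: U_def\<close>)
    qed (use k p1 posR v_nonpos in \<open>auto simp: U_def\<close>)
    then obtain w where w: "\<And>t. t \<in> U \<Longrightarrow> (v has_real_derivative w t) (at t within U)"
      "\<And>t. t \<in> U \<Longrightarrow> 4 * t * w t + 2 * real k * v t + g t powr p = 0"
      by blast
    define f where "f r = g (r\<^sup>2)" for r
    define f1 where "f1 r = 2 * r * v (r\<^sup>2)" for r
    define P where "P = pohozaev k p f f1"
    have f_nonneg: "0 \<le> f r" if "r \<in> {0..sqrt R}" for r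
    proof -
      have "r\<^sup>2 \<le> R" using that R0 power_mono[of r "sqrt R" 2] by simp
      then show ?thesis using posR[of "r\<^sup>2"] gR by (cases "r\<^sup>2 = R") (auto simp: f_def)
    qed
    have "P (sqrt R) \<le> P 0"
    proof (rule DERIV_nonpos_imp_decreasing_open[of 0 "sqrt R" P])
      show "0 \<le> sqrt R" using R0 by simp
      have "continuous_on {0..sqrt R} f" "continuous_on {0..sqrt R} f1"
        unfolding f_def f1_def
        by (intro continuous_intros continuous_on_compose2[OF contg] continuous_on_compose2[OF contv]; auto)+
      then show "continuous_on {0..sqrt R} P"
        unfolding P_def pohozaev_def[abs_def] using f_nonneg p1
        by (intro continuous_intros continuous_on_powr') auto
    next
      fix r assume r: "0 < r" "r < sqrt R"
      then have "r\<^sup>2 < (sqrt R)\<^sup>2" by (intro power_strict_mono) auto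
      then have rU: "0 < r\<^sup>2" "r\<^sup>2 < R" "r\<^sup>2 \<in> U" using r R0 by (auto simp: U_def)
      have int: "at (r\<^sup>2) within {0..} = at (r\<^sup>2)" "at (r\<^sup>2) within U = at (r\<^sup>2)"
        by (rule at_within_nhd[of _ "{0<..<R}"]; use rU in \<open>auto simp: U_def\<close>)+
      have sq: "((\<lambda>r. r\<^sup>2) has_real_derivative 2 * r) (at r)" by (auto intro!: derivative_eq_intros)
      have df: "(f has_real_derivative f1 r) (at r)"
        using DERIV_chain2[OF dg[of "r\<^sup>2", unfolded int] sq] by (simp add: f_def[abs_def] f1_def mult_ac)
      have df1: "(f1 has_real_derivative 2 * v (r\<^sup>2) + 2 * r * (w (r\<^sup>2) * (2 * r))) (at r)"
        unfolding f1_def[abs_def] using DERIV_chain2[OF w(1)[OF rU(3), unfolded int] sq]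
        by (auto intro!: derivative_eq_intros)
      have "(P has_real_derivative (real k / (p + 1) - (real k - 2) / 2) * r ^ (k - 1) * f r powr (p + 1)) (at r)"
        unfolding P_def
      proof (rule pohozaev_derivative[OF k _ r(1) _ df df1])
        show "2 * v (r\<^sup>2) + 2 * r * (w (r\<^sup>2) * (2 * r)) + (real k - 1) * f1 r / r + f r powr p = 0"
        proof -
          have "(real k - 1) * f1 r / r = (real k - 1) * (2 * v (r\<^sup>2))" using r by (simp add: f1_def)
          then show ?thesis
            using w(2)[OF rU(3)] by (simp add: f_def algebra_simps power2_eq_square)
        qed
      qed (use p1 posR rU in \<open>auto simp: f_def\<close>)
      moreover have "real k / (p + 1) - (real k - 2) / 2 \<le> 0"
        using p p1 k by (simp add: field_simps)
      then have "(real k / (p + 1) - (real k - 2) / 2) * r ^ (k - 1) * f r powr (p + 1) \<le> 0"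
        using r by (intro mult_nonpos_nonneg) auto
      ultimately show "\<exists>y. (P has_real_derivative y) (at r) \<and> y \<le> 0" by blast
    qed
    moreover have "P 0 = 0" unfolding P_def pohozaev_def using k by (simp add: power_0_left)
    moreover have "P (sqrt R) = (sqrt R) ^ k * (2 * R * (v R)\<^sup>2)"
      unfolding P_def pohozaev_def using R0 gR by (simp add: f_def f1_def power_mult_distrib)
    ultimately have "(sqrt R) ^ k * (2 * R * (v R)\<^sup>2) \<le> 0" by simp
    then have "v R = 0" using R0 by (simp add: mult_le_0_iff power_le_zero_eq)
    then have "integral {0..1} (\<lambda>\<sigma>. \<sigma> ^ (k - 1) * F (g (R * \<sigma>\<^sup>2))) = 0"
      by (simp add: v_def emden_slope_def)
    then have "\<forall>\<sigma>\<in>{0..1}. \<sigma> ^ (k - 1) * F (g (R * \<sigma>\<^sup>2)) = 0"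
      using integral_eq_0_iff[OF ci, of R] R0 F01 by simp
    then have "(1/2) ^ (k - 1) * F (g (R * (1/2)\<^sup>2)) = 0" by (rule bspec) simp
    then have "F (g (R / 4)) = 0" by (simp add: power2_eq_square)
    then show False using posR[of "R / 4"] R0 by (simp add: F_def min_def max_def split: if_splits)
  qed
  have "\<exists>w. continuous_on {0..} w \<and> (\<forall>s\<in>{0..}. (v has_real_derivative w s) (at s within {0..})
      \<and> 0 \<le> w s \<and> 4 * s * w s + 2 * real k * v s + g s powr p = 0)"
  proof (rule emden_regularity)
    show "v s = emden_slope k (\<lambda>t. g t powr p) s" if "s \<in> {0..}" for s
      using that pos by (intro v_eq) auto
  qed (use k p1 pos v_nonpos dg in \<open>auto simp: convex_real_interval\<close>)
  then obtain w where "continuous_on {0..} w" "\<forall>s\<in>{0..}. (v has_real_derivative w s) (at s within {0..})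
      \<and> 0 \<le> w s \<and> 4 * s * w s + 2 * real k * v s + g s powr p = 0"
    by blast
  then show ?thesis using pos dg by (intro exI[of _ g] exI[of _ v] exI[of _ w]) simp
qed

lemma exists_positive_solution:
  assumes k: "2 < k" "k < CARD('n)" and p: "(real k + 2) / (real k - 2) \<le> p"
  shows "\<exists>u :: real^'n \<Rightarrow> real. (\<forall>x. 0 < u x) \<and> classical_solution k p UNIV u"
proof -
  obtain g v w :: "real \<Rightarrow> real" where g: "\<And>s. 0 \<le> s \<Longrightarrow> 0 < g s"
    and d: "\<And>s. 0 \<le> s \<Longrightarrow> (g has_real_derivative v s) (at s within {0..})"
      "\<And>s. 0 \<le> s \<Longrightarrow> (v has_real_derivative w s) (at s within {0..})"
      "continuous_on {0..} w" and w: "\<And>s. 0 \<le> s \<Longrightarrow> 0 \<le> w s"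
    and ode: "\<And>s. 0 \<le> s \<Longrightarrow> 4 * s * w s + 2 * real k * v s + g s powr p = 0"
    using emden_regular_solution[OF k(1) p] by blast
  let ?u = "\<lambda>x :: real^'n. g ((norm (x - 0))\<^sup>2)"
  have "Pplus k (hessian ?u x) + ?u x powr p = 0" for x
    using radial_C2(2)[OF d, of k "0 :: real^'n" x] k w[of "(norm (x - 0))\<^sup>2"] ode[of "(norm (x - 0))\<^sup>2"]
    by (simp add: max_def)
  then show ?thesis
    using radial_C2(1)[OF d, of "0 :: real^'n"] g
    unfolding classical_solution_def by (intro exI[of _ ?u]) auto
qed

section \<open>Liouville property of viscosity supersolutions\<close>

text \<open>If no value were minimal, the open sets \<open>{x. f y < f x}\<close> would cover \<open>K\<close>; the smallest of the finitely
  many values of \<open>f\<close> at the centres of a subcover would have to exceed another one of them.\<close>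

lemma lower_semicontinuous_attains_inf:
  fixes f :: "'a::metric_space \<Rightarrow> real"
  assumes K: "compact K" "K \<noteq> {}" and f: "lower_semicontinuous_on K f"
  shows "\<exists>x\<in>K. \<forall>y\<in>K. f x \<le> f y"
proof (rule ccontr)
  assume not_attained: "\<not> (\<exists>x\<in>K. \<forall>y\<in>K. f x \<le> f y)"
  then have less: "\<exists>y\<in>K. f y < f x" if "x \<in> K" for x
    using that by (meson not_le)
  have "\<exists>T. open T \<and> K \<inter> T = {x \<in> K. f y < f x}" if "y \<in> K" for y
  proof -
    have "\<exists>e>0. \<forall>x'\<in>K. dist x' x < e \<longrightarrow> f y < f x'" if "x \<in> K" "f y < f x" for x
    proof -
      have "eventually (\<lambda>x'. f y < f x') (at x within K)"
        using f that by (simp add: lower_semicontinuous_on_def)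
      then obtain e where "0 < e" "\<forall>x'\<in>K. x' \<noteq> x \<and> dist x' x < e \<longrightarrow> f y < f x'"
        unfolding eventually_at by blast
      then show ?thesis using that(2) by metis
    qed
    then have "openin (top_of_set K) {x \<in> K. f y < f x}"
      unfolding openin_euclidean_subtopology_iff by auto
    then show ?thesis unfolding openin_open by blast
  qed
  then obtain T where T: "\<And>y. y \<in> K \<Longrightarrow> open (T y)" "\<And>y. y \<in> K \<Longrightarrow> K \<inter> T y = {x \<in> K. f y < f x}"
    by metis
  have "K \<subseteq> (\<Union>y\<in>K. T y)" using less T(2) by blast
  then obtain D where D: "D \<subseteq> K" "finite D" "K \<subseteq> (\<Union>y\<in>D. T y)"
    using compactE_image[OF K(1), of K T] T(1) by blast
  then have "D \<noteq> {}" using K(2) by auto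
  then obtain y where y: "y \<in> D" "\<And>y'. y' \<in> D \<Longrightarrow> f y \<le> f y'"
    using D(2) by (metis arg_min_if_finite(1) arg_min_if_finite(2) not_le)
  then obtain y' where y': "y' \<in> D" "y \<in> T y'" using D by blast
  then have "y \<in> K \<inter> T y'" using y(1) D(1) by blast
  then have "f y' < f y" using T(2)[of y'] y'(1) D(1) by auto
  then show False using y(2)[OF y'(1)] by simp
qed

lemma lower_semicontinuous_diff_continuous:
  fixes u f :: "'a::metric_space \<Rightarrow> real"
  assumes u: "lower_semicontinuous_on UNIV u" and f: "continuous_on UNIV f"
  shows "lower_semicontinuous_on K (\<lambda>x. u x - f x)"
  unfolding lower_semicontinuous_on_def
proof (intro ballI allI impI)
  fix x a assume "x \<in> K" and a: "a < u x - f x"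
  define e where "e = (u x - f x - a) / 2"
  have e: "0 < e" using a by (simp add: e_def)
  have "eventually (\<lambda>y. u x - e < u y) (at x)"
    using u e by (simp add: lower_semicontinuous_on_def)
  moreover have "eventually (\<lambda>y. f y < f x + e) (at x)"
    using f e by (intro order_tendstoD(2)[of f "f x"]) (auto simp: continuous_on_def)
  ultimately have "eventually (\<lambda>y. a < u y - f y) (at x)"
  proof eventually_elim
    case (elim y)
    moreover have "2 * e = u x - f x - a" by (simp add: e_def)
    ultimately show ?case by linarith
  qed
  then show "eventually (\<lambda>y. a < u y - f y) (at x within K)"
    by (rule filter_leD[OF at_le[OF subset_UNIV]])
qed

lemma lower_semicontinuous_divide_continuous:
  fixes u w :: "'a::metric_space \<Rightarrow> real"
  assumes u: "lower_semicontinuous_on UNIV u" and w: "continuous_on UNIV w" "\<And>x. x \<in> K \<Longrightarrow> 0 < w x"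
  shows "lower_semicontinuous_on K (\<lambda>x. u x / w x)"
  unfolding lower_semicontinuous_on_def
proof (intro ballI allI impI)
  fix x a assume x: "x \<in> K" and a: "a < u x / w x"
  then have "a * w x < u x" using w(2) by (simp add: pos_less_divide_eq)
  then obtain m where m: "a * w x < m" "m < u x" using dense by blast
  have "eventually (\<lambda>y. m < u y) (at x)"
    using u m by (simp add: lower_semicontinuous_on_def)
  moreover have "eventually (\<lambda>y. a * w y < m) (at x)"
    using w(1) m by (intro order_tendstoD(2)[of _ "a * w x"] tendsto_mult_left) (auto simp: continuous_on_def)
  ultimately have "eventually (\<lambda>y. a * w y < u y) (at x)"
    by eventually_elim simp
  then have "eventually (\<lambda>y. a * w y < u y) (at x within K)"
    by (rule filter_leD[OF at_le[OF subset_UNIV]])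
  moreover have "eventually (\<lambda>y. y \<in> K) (at x within K)" by (simp add: eventually_at_filter)
  ultimately show "eventually (\<lambda>y. a < u y / w y) (at x within K)"
    by eventually_elim (simp add: w(2) pos_less_divide_eq)
qed

text \<open>Touching from below by a radial function gives the inequality with the \<open>k\<close>-dimensional Laplacian,
  which is never larger than \<open>Pplus\<close>.\<close>

lemma radial_test_function:
  fixes z :: "real^'n"
  assumes k: "0 < k" "k < CARD('n)"
    and super: "nonneg_viscosity_supersolution k p UNIV u"
    and g: "\<And>s. 0 \<le> s \<Longrightarrow> (g has_real_derivative g1 s) (at s within {0..})"
      "\<And>s. 0 \<le> s \<Longrightarrow> (g1 has_real_derivative g2 s) (at s within {0..})" "continuous_on {0..} g2"
    and min: "local_min_on UNIV (\<lambda>y. u y - g ((norm (y - z))\<^sup>2)) x"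
  shows "u x powr p \<le> - (2 * real k * g1 ((norm (x - z))\<^sup>2) + 4 * (norm (x - z))\<^sup>2 * g2 ((norm (x - z))\<^sup>2))"
proof -
  have "Pplus k (hessian (\<lambda>y. g ((norm (y - z))\<^sup>2)) x) + u x powr p \<le> 0"
    using super radial_C2(1)[OF g] min unfolding nonneg_viscosity_supersolution_def by blast
  moreover have "Pplus k (hessian (\<lambda>y. g ((norm (y - z))\<^sup>2)) x)
      = 2 * real k * g1 ((norm (x - z))\<^sup>2) + max 0 (4 * (norm (x - z))\<^sup>2 * g2 ((norm (x - z))\<^sup>2))"
    by (rule radial_C2(2)[OF g k])
  ultimately show ?thesis by linarith
qed

text \<open>If \<open>u\<close> were smaller than the comparison function somewhere, their difference would attain a negative
  minimum at a point strictly inside a large annulus, because \<open>u \<ge> 0\<close> and the comparison function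
  tends to \<open>0\<close>; there the strict inequality contradicts the definition of a viscosity supersolution.\<close>

lemma exterior_comparison:
  fixes z :: "real^'n"
  assumes k: "0 < k" "k < CARD('n)"
    and super: "nonneg_viscosity_supersolution k p UNIV u"
    and g: "\<And>s. 0 \<le> s \<Longrightarrow> (g has_real_derivative g1 s) (at s within {0..})"
      "\<And>s. 0 \<le> s \<Longrightarrow> (g1 has_real_derivative g2 s) (at s within {0..})" "continuous_on {0..} g2"
    and \<rho>: "0 < \<rho>"
    and boundary: "\<And>y. norm (y - z) = \<rho> \<Longrightarrow> g (\<rho>\<^sup>2) \<le> u y"
    and decay: "(g \<longlongrightarrow> 0) at_top"
    and strict: "\<And>y. \<rho> < norm (y - z) \<Longrightarrow>
      - (u y powr p) < 2 * real k * g1 ((norm (y - z))\<^sup>2) + 4 * (norm (y - z))\<^sup>2 * g2 ((norm (y - z))\<^sup>2)"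
    and x: "\<rho> \<le> norm (x - z)"
  shows "g ((norm (x - z))\<^sup>2) \<le> u x"
proof (rule ccontr)
  assume below: "\<not> ?thesis"
  define f where "f y = u y - g ((norm (y - z))\<^sup>2)" for y
  have neg: "f x < 0" using below by (simp add: f_def)
  have lsc: "lower_semicontinuous_on UNIV u" and nn: "0 \<le> u y" for y
    using super by (auto simp: nonneg_viscosity_supersolution_def)
  have "eventually (\<lambda>s. g s < - f x) at_top"
    using neg by (intro order_tendstoD(2)[OF decay]) simp
  then obtain S where S: "\<And>s. S \<le> s \<Longrightarrow> g s < - f x"
    unfolding eventually_at_top_linorder by blast
  define R where "R = max (norm (x - z)) (max S 0) + 1"
  have R: "norm (x - z) < R" "\<rho> < R" "1 \<le> R" "S \<le> R" using x by (auto simp: R_def)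
  have "S \<le> R\<^sup>2" using R(3,4) self_le_power[of R 2] by simp
  then have gR: "g (R\<^sup>2) < - f x" by (rule S)
  define K where "K = cball z R - ball z \<rho>"
  have "continuous_on {0..} g"
    using g(1) by (auto simp: continuous_on_eq_continuous_within intro: DERIV_continuous)
  then have contg: "continuous_on UNIV (\<lambda>y. g ((norm (y - z))\<^sup>2))"
    by (rule continuous_on_compose2) (auto intro!: continuous_intros)
  have xK: "x \<in> K" using x R by (simp add: K_def dist_norm norm_minus_commute)
  have "\<exists>y\<in>K. \<forall>y'\<in>K. f y \<le> f y'"
  proof (rule lower_semicontinuous_attains_inf)
    show "compact K" unfolding K_def by (intro compact_diff compact_cball open_ball)
    show "K \<noteq> {}" using xK by blast
    show "lower_semicontinuous_on K f"
      unfolding f_def by (rule lower_semicontinuous_diff_continuous[OF lsc contg])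
  qed
  then obtain y where y: "y \<in> K" "\<And>y'. y' \<in> K \<Longrightarrow> f y \<le> f y'" by blast
  have fy: "f y \<le> f x" using y(2)[OF xK] .
  have ny: "\<rho> \<le> norm (y - z)" "norm (y - z) \<le> R"
    using y(1) by (simp_all add: K_def dist_norm norm_minus_commute)
  have "norm (y - z) \<noteq> \<rho>"
  proof
    assume "norm (y - z) = \<rho>"
    then have "0 \<le> f y" using boundary[of y] by (simp add: f_def)
    then show False using fy neg by simp
  qed
  moreover have "norm (y - z) \<noteq> R"
  proof
    assume "norm (y - z) = R"
    then have "f x < f y" using gR nn[of y] by (simp add: f_def)
    then show False using fy by simp
  qed
  ultimately have y_in: "\<rho> < norm (y - z)" "norm (y - z) < R" using ny by auto
  have "open (ball z R - cball z \<rho>)" by (intro open_Diff open_ball closed_cball)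
  moreover have "y \<in> ball z R - cball z \<rho>" using y_in by (simp add: dist_norm norm_minus_commute)
  ultimately have "eventually (\<lambda>y'. y' \<in> ball z R - cball z \<rho>) (at y)"
    by (rule eventually_at_in_open')
  then have "eventually (\<lambda>y'. f y \<le> f y') (at y)"
    by eventually_elim (auto intro!: y(2) simp: K_def)
  then have "local_min_on UNIV (\<lambda>y. u y - g ((norm (y - z))\<^sup>2)) y"
    by (simp add: local_min_on_def f_def)
  from radial_test_function[OF k super g this] strict[OF y_in(1)]
  show False by linarith
qed

lemma power_profile_derivatives:
  fixes \<epsilon> d :: real
  assumes "0 < \<epsilon>" "0 \<le> s"
  shows "((\<lambda>s. (\<epsilon> + s) powr (-d)) has_real_derivative - d * (\<epsilon> + s) powr (-d - 1)) (at s within {0..})"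
    and "((\<lambda>s. - d * (\<epsilon> + s) powr (-d - 1)) has_real_derivative d * (d + 1) * (\<epsilon> + s) powr (-d - 2)) (at s within {0..})"
  using assms by (auto intro!: derivative_eq_intros simp: algebra_simps)

lemma powr_eq_powr_mult_self: "t powr e = t powr d * t" if "0 < t" "e = d + 1" for t d e :: real
  using that by (simp add: powr_add)

text \<open>The exponent \<open>d = b\<close> is that of the fundamental solution in dimension \<open>k\<close>; the second term is the error
  caused by the shift \<open>\<epsilon>\<close>, which makes the function smooth at the centre.\<close>

lemma power_profile_operator:
  fixes \<epsilon> d b s :: real
  assumes "0 < \<epsilon> + s" and b: "real k = 2 * (b + 1)"
  shows "2 * real k * (- d * (\<epsilon> + s) powr (-d - 1)) + 4 * s * (d * (d + 1) * (\<epsilon> + s) powr (-d - 2))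
    = 4 * d * (d - b) * (\<epsilon> + s) powr (-d - 1) - 4 * \<epsilon> * d * (d + 1) * (\<epsilon> + s) powr (-d - 2)"
proof -
  have "(\<epsilon> + s) powr (-d - 1) = (\<epsilon> + s) powr (-d - 2) * (\<epsilon> + s)"
    by (rule powr_eq_powr_mult_self[OF assms(1)]) simp
  then show ?thesis unfolding b by (simp add: algebra_simps)
qed

text \<open>The comparison function \<open>t\<^bsup>-b\<^esup> + t\<^bsup>-b-1\<^esup>\<close>, \<open>t = \<epsilon> + s\<close>, is a strict subsolution outside a ball on
  which \<open>u\<close> is bounded below: the second summand has a positive image of order \<open>t\<^bsup>-b-2\<^esup>\<close>, which
  absorbs the errors of order \<open>\<epsilon>\<close> if \<open>\<epsilon>\<close> is small relative to the radius of the ball.\<close>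

lemma supersolution_lower_bound:
  fixes z :: "real^'n"
  assumes k: "2 < k" "k < CARD('n)"
    and super: "nonneg_viscosity_supersolution k p UNIV u" and z: "0 < u z"
    and b: "real k = 2 * (b + 1)"
  obtains c where "0 < c" "\<And>x. c * (1 + (norm (x - z))\<^sup>2) powr (-b) \<le> u x"
proof -
  have b0: "0 < b" using k(1) b by simp
  have lsc: "lower_semicontinuous_on UNIV u"
    using super by (auto simp: nonneg_viscosity_supersolution_def)
  define \<delta> where "\<delta> = u z / 2"
  have \<delta>: "0 < \<delta>" "\<delta> < u z" using z by (simp_all add: \<delta>_def)
  then have "eventually (\<lambda>y. \<delta> < u y) (at z)" using lsc by (simp add: lower_semicontinuous_on_def)
  then obtain r where r: "0 < r" "\<And>y. y \<noteq> z \<Longrightarrow> dist y z < r \<Longrightarrow> \<delta> < u y"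
    unfolding eventually_at by auto
  define \<rho> where "\<rho> = r / 2"
  have \<rho>: "0 < \<rho>" using r by (simp add: \<rho>_def)
  have near: "\<delta> \<le> u y" if "norm (y - z) \<le> \<rho>" for y
    using r(2)[of y] that r(1) \<delta> by (cases "y = z") (auto simp: \<rho>_def dist_norm intro: less_imp_le)
  define D where "D = 1 + b + (b + 2) / \<rho>\<^sup>2"
  define \<epsilon> where "\<epsilon> = 1 / D"
  have D: "1 < D" using b0 \<rho> by (simp add: D_def add_pos_nonneg)
  have \<epsilon>: "0 < \<epsilon>" "\<epsilon> \<le> 1" using D by (simp_all add: \<epsilon>_def)
  define G where "G s = (\<epsilon> + s) powr (-b) + (\<epsilon> + s) powr (-(b + 1))" for s
  define c1 where "c1 = \<delta> / G (\<rho>\<^sup>2)"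
  have "0 < G (\<rho>\<^sup>2)" unfolding G_def using \<epsilon> by (intro add_pos_pos) (simp_all add: add_pos_nonneg less_imp_neq[symmetric])
  then have c1: "0 < c1" "c1 * G (\<rho>\<^sup>2) = \<delta>" using \<delta> by (simp_all add: c1_def)
  define g where "g s = c1 * G s" for s
  define g1 where "g1 s = c1 * (- b * (\<epsilon> + s) powr (-b - 1) + - (b + 1) * (\<epsilon> + s) powr (-(b + 1) - 1))" for s
  define g2 where "g2 s = c1 * (b * (b + 1) * (\<epsilon> + s) powr (-b - 2) + (b + 1) * (b + 1 + 1) * (\<epsilon> + s) powr (-(b + 1) - 2))" for s
  have dg: "(g has_real_derivative g1 s) (at s within {0..})" if "0 \<le> s" for s
    unfolding g_def g1_def G_def
    by (intro DERIV_cmult DERIV_add power_profile_derivatives \<epsilon> that)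
  have dg1: "(g1 has_real_derivative g2 s) (at s within {0..})" if "0 \<le> s" for s
    unfolding g1_def g2_def
    by (intro DERIV_cmult DERIV_add power_profile_derivatives \<epsilon> that)
  have cg2: "continuous_on {0..} g2"
    unfolding g2_def using \<epsilon> by (intro continuous_intros) (auto simp: add_pos_nonneg less_imp_neq[symmetric])
  have tendsto: "((\<lambda>s. (\<epsilon> + s) powr (-d)) \<longlongrightarrow> 0) at_top" if "0 < d" for d
    by (intro tendsto_neg_powr filterlim_tendsto_add_at_top[OF tendsto_const] filterlim_ident) (use that in simp)
  have "(g \<longlongrightarrow> c1 * (0 + 0)) at_top"
    unfolding g_def G_def using b0 by (intro tendsto_mult tendsto_const tendsto_add tendsto) auto
  then have lim: "(g \<longlongrightarrow> 0) at_top" by simp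
  have op: "0 < 2 * real k * g1 s + 4 * s * g2 s" if s: "\<rho>\<^sup>2 \<le> s" for s
  proof -
    define t where "t = \<epsilon> + s"
    have t: "0 < t" "\<rho>\<^sup>2 \<le> t" using s \<epsilon> zero_le_power2[of \<rho>] unfolding t_def by linarith+
    define E where "E = t powr (-b - 3)"
    have E: "0 < E" "t powr (-b - 2) = E * t"
    proof -
      show "t powr (-b - 2) = E * t"
        unfolding E_def by (rule powr_eq_powr_mult_self[OF t(1)]) simp
    qed (use t in \<open>simp add: E_def\<close>)
    have "2 * real k * g1 s + 4 * s * g2 s
      = c1 * ((2 * real k * (- b * t powr (-b - 1)) + 4 * s * (b * (b + 1) * t powr (-b - 2)))
        + (2 * real k * (- (b + 1) * t powr (-(b + 1) - 1)) + 4 * s * ((b + 1) * (b + 1 + 1) * t powr (-(b + 1) - 2))))"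
      by (simp add: g1_def g2_def t_def algebra_simps)
    also have "\<dots> = c1 * (- 4 * \<epsilon> * b * (b + 1) * t powr (-b - 2)
        + (4 * (b + 1) * t powr (-(b + 1) - 1) - 4 * \<epsilon> * (b + 1) * (b + 1 + 1) * t powr (-(b + 1) - 2)))"
      unfolding t_def
      by (subst (1 2) power_profile_operator[OF _ b]) (use t in \<open>simp_all add: t_def\<close>)
    also have "-(b + 1) - 1 = -b - 2" by simp
    also have "-(b + 1) - 2 = -b - 3" by simp
    also have "c1 * (- 4 * \<epsilon> * b * (b + 1) * t powr (-b - 2)
        + (4 * (b + 1) * t powr (-b - 2) - 4 * \<epsilon> * (b + 1) * (b + 1 + 1) * t powr (-b - 3)))
      = c1 * (4 * (b + 1) * E * (t - \<epsilon> * (b * t + (b + 2))))"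
      unfolding E(2) E_def[symmetric] by (simp add: algebra_simps)
    finally have eq: "2 * real k * g1 s + 4 * s * g2 s = c1 * (4 * (b + 1) * E * (t - \<epsilon> * (b * t + (b + 2))))" .
    have "b + 2 \<le> (b + 2) / \<rho>\<^sup>2 * t"
    proof -
      have "(b + 2) * \<rho>\<^sup>2 \<le> (b + 2) * t" using t b0 by (intro mult_left_mono) auto
      then show ?thesis using \<rho> by (simp add: pos_le_divide_eq)
    qed
    then have "b * t + (b + 2) < D * t" using t by (simp add: D_def algebra_simps)
    then have "\<epsilon> * (b * t + (b + 2)) < \<epsilon> * (D * t)" using \<epsilon> by (intro mult_strict_left_mono)
    then have "\<epsilon> * (b * t + (b + 2)) < t" using D by (simp add: \<epsilon>_def)
    then show ?thesis unfolding eq using c1 b0 E by (intro mult_pos_pos) auto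
  qed
  have far: "g ((norm (x - z))\<^sup>2) \<le> u x" if "\<rho> \<le> norm (x - z)" for x
  proof (rule exterior_comparison[OF _ k(2) super dg dg1 cg2 \<rho> _ lim _ that])
    show "g (\<rho>\<^sup>2) \<le> u y" if "norm (y - z) = \<rho>" for y
      using near[of y] that c1 by (simp add: g_def)
    show "- (u y powr p) < 2 * real k * g1 ((norm (y - z))\<^sup>2) + 4 * (norm (y - z))\<^sup>2 * g2 ((norm (y - z))\<^sup>2)"
      if "\<rho> < norm (y - z)" for y
      using op[of "(norm (y - z))\<^sup>2"] that \<rho> power_mono[of \<rho> "norm (y - z)" 2] powr_ge_zero[of "u y" p]
      by linarith
  qed (use k in simp)
  show ?thesis
  proof (rule that[of "min c1 \<delta>"])
    show "0 < min c1 \<delta>" using c1 \<delta> by simp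
    fix x
    define s where "s = (norm (x - z))\<^sup>2"
    have s: "0 \<le> s" by (simp add: s_def)
    have le1: "(1 + s) powr (-b) \<le> 1" using s b0 powr_mono[of "-b" 0 "1 + s"] by simp
    show "min c1 \<delta> * (1 + (norm (x - z))\<^sup>2) powr (-b) \<le> u x"
    proof (cases "norm (x - z) \<le> \<rho>")
      case True
      have "min c1 \<delta> * (1 + s) powr (-b) \<le> \<delta> * 1"
        using le1 \<delta> c1 by (intro mult_mono) auto
      then show ?thesis using near[OF True] by (simp add: s_def)
    next
      case False
      have "(1 + s) powr (-b) \<le> (\<epsilon> + s) powr (-b)" using \<epsilon> s b0 by (intro powr_mono2') auto
      also have "\<dots> \<le> G s" by (simp add: G_def)
      finally have "min c1 \<delta> * (1 + s) powr (-b) \<le> c1 * G s"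
        using c1 \<delta> by (intro mult_mono) auto
      then show ?thesis using far[of x] False by (simp add: s_def g_def)
    qed
  qed
qed

text \<open>The operator maps \<open>t\<^bsup>-b\<^esup> ln t\<close>, \<open>t = 1 + s\<close>, to a function bounded below by \<open>- 4 b (b + 2) t\<^bsup>-b-1\<^esup>\<close>.
  This is the order of decay of the source term \<open>u\<^sup>p \<ge> c0\<^sup>p t\<^bsup>-bp\<^esup>\<close> in the worst case \<open>b p = b + 1\<close>, so a
  small multiple of \<open>t\<^bsup>-b\<^esup> ln t\<close> stays below \<open>u\<close>.\<close>

lemma supersolution_log_lower_bound:
  fixes z :: "real^'n"
  assumes k: "2 < k" "k < CARD('n)" and p: "0 < p" "p \<le> real k / (real k - 2)"
    and super: "nonneg_viscosity_supersolution k p UNIV u"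
    and b: "real k = 2 * (b + 1)"
    and c0: "0 < c0" "\<And>x. c0 * (1 + (norm (x - z))\<^sup>2) powr (-b) \<le> u x"
  obtains c where "0 < c"
    "\<And>x. 1 \<le> norm (x - z) \<Longrightarrow> c * (1 + (norm (x - z))\<^sup>2) powr (-b) * ln (1 + (norm (x - z))\<^sup>2) \<le> u x"
proof -
  have b0: "0 < b" using k(1) b by simp
  have bp: "b * p \<le> b + 1"
    using p(2) b b0 by (simp add: field_simps)
  define c where "c = min c0 (c0 powr p / (8 * b * (b + 2)))"
  have c: "0 < c" "c \<le> c0" "c * (4 * b * (b + 2)) < c0 powr p"
  proof -
    show "0 < c" using c0 b0 by (simp add: c_def)
    have "c \<le> c0 powr p / (8 * b * (b + 2))" by (simp add: c_def)
    then have "c * (8 * b * (b + 2)) \<le> c0 powr p" using b0 by (simp add: pos_le_divide_eq)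
    moreover have "0 < c0 powr p" using c0 by simp
    moreover have "c * (8 * b * (b + 2)) = 2 * (c * (4 * b * (b + 2)))" by simp
    ultimately show "c * (4 * b * (b + 2)) < c0 powr p" by linarith
  qed (simp add: c_def)
  define g where "g s = c * ((1 + s) powr (-b) * ln (1 + s))" for s :: real
  define g1 where "g1 s = c * ((1 + s) powr (-b - 1) * (1 - b * ln (1 + s)))" for s :: real
  define g2 where "g2 s = c * ((1 + s) powr (-b - 2) * (b * (b + 1) * ln (1 + s) - (2 * b + 1)))" for s :: real
  have shift: "(1 + s) powr (-b) = (1 + s) powr (-b - 1) * (1 + s)"
    "(1 + s) powr (-b - 1) = (1 + s) powr (-b - 2) * (1 + s)" if "0 \<le> s" for s :: real
    by (rule powr_eq_powr_mult_self; use that in simp)+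
  have dg: "(g has_real_derivative g1 s) (at s within {0..})" if s: "0 \<le> s" for s
  proof -
    have "(g has_real_derivative c * ((- b * (1 + s) powr (-b - 1)) * ln (1 + s) + 1 / (1 + s) * (1 + s) powr (-b))) (at s within {0..})"
      unfolding g_def using s by (intro DERIV_cmult DERIV_mult power_profile_derivatives) (auto intro!: derivative_eq_intros)
    moreover have eq: "1 / (1 + s) * (1 + s) powr (-b) = (1 + s) powr (-b - 1)"
      using shift(1)[OF s] s by simp
    have "c * ((- b * (1 + s) powr (-b - 1)) * ln (1 + s) + 1 / (1 + s) * (1 + s) powr (-b)) = g1 s"
      unfolding eq g1_def by (simp add: algebra_simps)
    ultimately show ?thesis by simp
  qed
  have dg1: "(g1 has_real_derivative g2 s) (at s within {0..})" if s: "0 \<le> s" for s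
  proof -
    have "((\<lambda>s. (1 + s) powr (-(b + 1))) has_real_derivative - (b + 1) * (1 + s) powr (-(b + 1) - 1)) (at s within {0..})"
      using s by (intro power_profile_derivatives) auto
    moreover have "-(b + 1) = -b - 1" "-b - 1 - 1 = -b - 2" by simp_all
    ultimately have d: "((\<lambda>s. (1 + s) powr (-b - 1)) has_real_derivative (-b - 1) * (1 + s) powr (-b - 2)) (at s within {0..})"
      by (simp only:)
    have "((\<lambda>s. 1 - b * ln (1 + s)) has_real_derivative - b * (1 / (1 + s))) (at s within {0..})"
      using s by (auto intro!: derivative_eq_intros)
    from DERIV_cmult[OF DERIV_mult[OF d this], of c]
    have "(g1 has_real_derivative c * (((-b - 1) * (1 + s) powr (-b - 2)) * (1 - b * ln (1 + s))
        + (- b * (1 / (1 + s))) * (1 + s) powr (-b - 1))) (at s within {0..})"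
      unfolding g1_def .
    moreover have "1 / (1 + s) * (1 + s) powr (-b - 1) = (1 + s) powr (-b - 2)"
      using shift(2)[OF s] s by simp
    then have eq: "(- b * (1 / (1 + s))) * (1 + s) powr (-b - 1) = - b * (1 + s) powr (-b - 2)"
      by (simp only: mult.assoc)
    have "c * (((-b - 1) * (1 + s) powr (-b - 2)) * (1 - b * ln (1 + s))
        + (- b * (1 / (1 + s))) * (1 + s) powr (-b - 1)) = g2 s"
      unfolding eq g2_def by (simp add: algebra_simps)
    ultimately show ?thesis by simp
  qed
  have cg2: "continuous_on {0..} g2"
    unfolding g2_def by (intro continuous_intros) auto
  have lim: "(g \<longlongrightarrow> 0) at_top"
    unfolding g_def using b0 by real_asymp
  have bound: "g ((norm (x - z))\<^sup>2) \<le> u x" if x: "1 \<le> norm (x - z)" for x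
  proof (rule exterior_comparison[OF _ k(2) super dg dg1 cg2 zero_less_one _ lim _ x])
    show "g (1\<^sup>2) \<le> u y" if "norm (y - z) = 1" for y
    proof -
      have "g 1 \<le> c0 * (2 powr (-b) * 1)"
        unfolding g_def using c c0 ln_2_less_1 by (intro mult_mono) auto
      then show ?thesis using c0(2)[of y] that by simp
    qed
    show "- (u y powr p) < 2 * real k * g1 ((norm (y - z))\<^sup>2) + 4 * (norm (y - z))\<^sup>2 * g2 ((norm (y - z))\<^sup>2)"
      if "1 < norm (y - z)" for y
    proof -
      define s where "s = (norm (y - z))\<^sup>2"
      have s: "0 \<le> s" by (simp add: s_def)
      define E L where "E = (1 + s) powr (-b - 2)" and "L = ln (1 + s)"
      have E: "0 < E" using s by (simp add: E_def)
      have E1: "(1 + s) powr (-b - 1) = E * (1 + s)"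
        using shift(2)[OF s] by (simp add: E_def)
      have L: "L \<le> 1 + s" using ln_le_minus_one[of "1 + s"] s by (simp add: L_def)
      have "2 * real k * g1 s + 4 * s * g2 s
          = c * E * (4 * (b + 1) * (1 + s) * (1 - b * L) + 4 * s * (b * (b + 1) * L - (2 * b + 1)))"
        unfolding g1_def g2_def E1 E_def[symmetric] L_def[symmetric] b by (simp add: algebra_simps)
      also have "\<dots> = c * E * (4 * (2 * b + 1) - 4 * b * (1 + s) - 4 * b * (b + 1) * L)"
        by (simp add: algebra_simps)
      finally have eq: "2 * real k * g1 s + 4 * s * g2 s = c * E * (4 * (2 * b + 1) - 4 * b * (1 + s) - 4 * b * (b + 1) * L)" .
      have "4 * b * (b + 1) * L \<le> 4 * b * (b + 1) * (1 + s)"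
        using L b0 by (intro mult_left_mono) auto
      then have "- (4 * b * (b + 2)) * (1 + s) \<le> 4 * (2 * b + 1) - 4 * b * (1 + s) - 4 * b * (b + 1) * L"
        using b0 by (simp add: algebra_simps)
      then have "c * E * (- (4 * b * (b + 2)) * (1 + s)) \<le> 2 * real k * g1 s + 4 * s * g2 s"
        unfolding eq using c E by (intro mult_left_mono) auto
      moreover have "c * E * (- (4 * b * (b + 2)) * (1 + s)) = - (c * (4 * b * (b + 2)) * (E * (1 + s)))"
        by (simp add: algebra_simps)
      moreover have "c * (4 * b * (b + 2)) * (E * (1 + s)) < c0 powr p * (E * (1 + s))"
        using c E s by (intro mult_strict_right_mono) auto
      moreover have "c0 powr p * (E * (1 + s)) \<le> u y powr p"
      proof -
        have "(1 + s) powr (-b - 1) \<le> (1 + s) powr (-b * p)" using bp s by (intro powr_mono) auto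
        then have "c0 powr p * (E * (1 + s)) \<le> c0 powr p * (1 + s) powr (-b * p)"
          unfolding E1 by (intro mult_left_mono) auto
        also have "\<dots> = (c0 * (1 + s) powr (-b)) powr p"
          using c0 s by (simp add: powr_mult powr_powr)
        also have "\<dots> \<le> u y powr p"
          using c0 s p by (intro powr_mono2) (auto simp: s_def)
        finally show ?thesis .
      qed
      ultimately show ?thesis unfolding s_def[symmetric] by linarith
    qed
  qed (use k in simp)
  then show ?thesis using that[OF c(1)] by (simp add: g_def mult.assoc)
qed

text \<open>The ratio \<open>u / w\<close> with \<open>w = s (\<epsilon> + s)\<^bsup>-a-1\<^esup>\<close> tends to infinity both at the centre, where \<open>w\<close>
  vanishes, and at infinity, where \<open>w\<close> decays faster than the lower bound of \<open>u\<close> as \<open>a > b\<close>. So it attains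
  its infimum \<open>M\<close>, and \<open>M w\<close> touches \<open>u\<close> from below. Up to a positive factor, minus the operator applied
  to \<open>w\<close> is the quadratic polynomial \<open>q\<close> in \<open>t = \<epsilon> + s\<close>, which is positive only for \<open>t\<close> between two multiples
  of \<open>\<epsilon>\<close>, the smaller of which exceeds \<open>\<epsilon>\<close>. The last bound, \<open>u \<le> C \<epsilon>\<close>, results from comparing \<open>M\<close> with the
  ratio at a fixed point \<open>x1\<close>.\<close>

lemma supersolution_touching_point:
  fixes z :: "real^'n"
  assumes k: "2 < k" "k < CARD('n)"
    and super: "nonneg_viscosity_supersolution k p UNIV u"
    and b: "real k = 2 * (b + 1)"
    and c0: "0 < c0" "\<And>x. c0 * (1 + (norm (x - z))\<^sup>2) powr (-b) \<le> u x"
  shows "\<exists>C \<kappa> T. 0 < C \<and> 0 < \<kappa> \<and> 0 < T \<and> (\<forall>\<epsilon>\<ge>1. \<exists>x. \<kappa> * \<epsilon> \<le> (norm (x - z))\<^sup>2 \<and> (norm (x - z))\<^sup>2 \<le> T * \<epsilon>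
    \<and> u x powr (p - 1) \<le> C / \<epsilon> \<and> u x \<le> C * \<epsilon>)"
proof -
  have b0: "0 < b" using k(1) b by simp
  have lsc: "lower_semicontinuous_on UNIV u"
    using super by (auto simp: nonneg_viscosity_supersolution_def)
  have upos: "0 < u x" for x
    using c0(2)[of x] c0(1) by (smt (verit) mult_pos_pos powr_gt_zero zero_le_power2)
  define a where "a = b + 1/2"
  have a0: "0 < a" using b0 by (simp add: a_def)
  define T where "T = 2 * (a + 1) * (b + 2) / a"
  define \<kappa> where "\<kappa> = 1 / (2 * b + 4)"
  define x1 :: "real^'n" where "x1 = z + axis undefined 1"
  have x1: "norm (x1 - z) = 1" by (simp add: x1_def)
  define C where "C = max (4 * (a + 1) * (b + 2) * (2 * b + 4)) (u x1 * T * 2 powr (a + 1))"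
  have T: "0 < T" and \<kappa>: "0 < \<kappa>" and C: "0 < C"
    using a0 b0 by (simp_all add: T_def \<kappa>_def C_def less_max_iff_disj)
  have "\<exists>x. \<kappa> * \<epsilon> \<le> (norm (x - z))\<^sup>2 \<and> (norm (x - z))\<^sup>2 \<le> T * \<epsilon>
    \<and> u x powr (p - 1) \<le> C / \<epsilon> \<and> u x \<le> C * \<epsilon>" if \<epsilon>: "1 \<le> \<epsilon>" for \<epsilon> :: real
  proof -
    have \<epsilon>0: "0 < \<epsilon>" using \<epsilon> by simp
    define W where "W s = s * (\<epsilon> + s) powr (-a - 1)" for s
    define w where "w x = W ((norm (x - z))\<^sup>2)" for x :: "real^'n"
    have Wpos: "0 < W s" if "0 < s" for s using that \<epsilon>0 by (simp add: W_def)
    have contw: "continuous_on UNIV w"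
      unfolding w_def W_def using \<epsilon>0
      by (intro continuous_intros) (auto simp: add_pos_nonneg less_imp_neq[symmetric])
    define m1 where "m1 = u x1 / w x1"
    have m1: "0 < m1" using upos[of x1] Wpos[of 1] by (simp add: m1_def w_def x1)
    define r0 where "r0 = min 1 (c0 * 2 powr (-b) / m1)"
    define r1 where "r1 = max 1 ((m1 / c0)\<^sup>2)"
    define K where "K = {x :: real^'n. r0 \<le> (norm (x - z))\<^sup>2 \<and> (norm (x - z))\<^sup>2 \<le> r1}"
    have r0: "0 < r0" "r0 \<le> 1" using c0 m1 by (simp_all add: r0_def)
    have r1: "1 \<le> r1" by (simp add: r1_def)
    have x1K: "x1 \<in> K" using r0 r1 by (simp add: K_def x1)
    have wpos: "0 < w y" if "y \<in> K" for y
    proof -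
      have "0 < (norm (y - z))\<^sup>2" using that r0 unfolding K_def mem_Collect_eq by linarith
      then show ?thesis unfolding w_def by (rule Wpos)
    qed
    have "compact K"
      unfolding compact_eq_bounded_closed
    proof
      have "K \<subseteq> cball z r1"
      proof
        fix x assume "x \<in> K"
        then have "(norm (x - z))\<^sup>2 \<le> r1" by (simp add: K_def)
        also have "r1 \<le> r1\<^sup>2" using r1 by (rule self_le_power) simp
        finally have "norm (x - z) \<le> r1" by (rule power2_le_imp_le) (use r1 in simp)
        then show "x \<in> cball z r1" by (simp add: dist_norm norm_minus_commute)
      qed
      then show "bounded K" using bounded_cball bounded_subset by blast
      show "closed K" unfolding K_def
        by (intro closed_Collect_conj closed_Collect_le continuous_intros)
    qed
    moreover have "lower_semicontinuous_on K (\<lambda>x. u x / w x)"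
      by (rule lower_semicontinuous_divide_continuous[OF lsc contw wpos])
    ultimately obtain x where x: "x \<in> K" "\<And>y. y \<in> K \<Longrightarrow> u x / w x \<le> u y / w y"
      using lower_semicontinuous_attains_inf[of K "\<lambda>x. u x / w x"] x1K by blast
    define M where "M = u x / w x"
    have Mm1: "M \<le> m1" using x(2)[OF x1K] by (simp add: M_def m1_def)
    define s where "s = (norm (x - z))\<^sup>2"
    have "r0 \<le> s" using x(1) by (simp add: K_def s_def)
    then have s: "0 < s" using r0 by linarith
    have wx: "w x = W s" "0 < w x" using Wpos[OF s] by (simp_all add: w_def s_def)
    have M: "0 < M" "u x = M * W s" using upos[of x] wx by (simp_all add: M_def)
    have touch: "M * w y \<le> u y" for y
    proof (cases "y \<in> K")
      case True
      then have "0 < w y" by (rule wpos)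
      then show ?thesis using x(2)[OF True] by (simp add: M_def pos_le_divide_eq)
    next
      case False
      define \<sigma> where "\<sigma> = (norm (y - z))\<^sup>2"
      have \<sigma>: "0 \<le> \<sigma>" by (simp add: \<sigma>_def)
      have "m1 * W \<sigma> \<le> c0 * (1 + \<sigma>) powr (-b)"
      proof (cases "\<sigma> < r0")
        case True
        have "(\<epsilon> + \<sigma>) powr (-a - 1) \<le> 1" using powr_mono[of "-a - 1" 0 "\<epsilon> + \<sigma>"] \<epsilon> \<sigma> a0 by simp
        then have "W \<sigma> \<le> \<sigma> * 1" unfolding W_def using \<sigma> by (intro mult_left_mono) auto
        also have "\<dots> \<le> c0 * 2 powr (-b) / m1" using True by (simp add: r0_def)
        finally have "m1 * W \<sigma> \<le> c0 * 2 powr (-b)" using m1 by (simp add: pos_le_divide_eq mult.commute)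
        also have "\<dots> \<le> c0 * (1 + \<sigma>) powr (-b)"
          using True r0 \<sigma> c0 b0 by (intro mult_left_mono powr_mono2') auto
        finally show ?thesis .
      next
        case False
        then have "r1 < \<sigma>" using \<open>y \<notin> K\<close> by (simp add: K_def \<sigma>_def)
        then have "(m1 / c0)\<^sup>2 \<le> \<sigma>" by (simp add: r1_def)
        then have "m1 / c0 \<le> sqrt \<sigma>" using real_le_rsqrt by blast
        also have "\<dots> \<le> (1 + \<sigma>) powr (1/2)" using \<sigma> by (simp add: powr_half_sqrt)
        finally have m1c: "m1 \<le> c0 * (1 + \<sigma>) powr (1/2)" using c0 by (simp add: pos_divide_le_eq mult.commute)
        have "W \<sigma> \<le> (1 + \<sigma>) * (1 + \<sigma>) powr (-a - 1)"
          unfolding W_def using \<sigma> \<epsilon> a0 by (intro mult_mono powr_mono2') auto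
        also have "\<dots> = (1 + \<sigma>) powr (-a)"
          using \<sigma> powr_add[of "1 + \<sigma>" 1 "-a - 1"] by simp
        finally have "m1 * W \<sigma> \<le> (c0 * (1 + \<sigma>) powr (1/2)) * (1 + \<sigma>) powr (-a)"
          using m1c m1 c0 \<sigma> by (intro mult_mono) (auto simp: W_def)
        also have "\<dots> = c0 * (1 + \<sigma>) powr (-b)"
          by (simp add: a_def mult.assoc flip: powr_add)
        finally show ?thesis .
      qed
      moreover have "M * W \<sigma> \<le> m1 * W \<sigma>" using Mm1 \<sigma> by (intro mult_right_mono) (simp_all add: W_def)
      ultimately show ?thesis using c0(2)[of y] by (simp add: w_def \<sigma>_def)
    qed
    define g1 where "g1 s = M * (- a * (\<epsilon> + s) powr (-a - 1) + - \<epsilon> * (- (a + 1) * (\<epsilon> + s) powr (-(a + 1) - 1)))" for s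
    define g2 where "g2 s = M * (a * (a + 1) * (\<epsilon> + s) powr (-a - 2) + - \<epsilon> * ((a + 1) * (a + 1 + 1) * (\<epsilon> + s) powr (-(a + 1) - 2)))" for s
    define g where "g s = M * ((\<epsilon> + s) powr (-a) + - \<epsilon> * (\<epsilon> + s) powr (-(a + 1)))" for s
    have gW: "g s = M * W s" if "0 \<le> s" for s
    proof -
      have A: "(\<epsilon> + s) powr (-a) = (\<epsilon> + s) * (\<epsilon> + s) powr (-a - 1)"
        using that \<epsilon>0 powr_add[of "\<epsilon> + s" 1 "-a - 1"] by simp
      have e: "-(a + 1) = -a - 1" by simp
      define X where "X = (\<epsilon> + s) powr (-a - 1)"
      show ?thesis unfolding g_def W_def A e X_def[symmetric] by (simp add: algebra_simps)
    qed
    have dg: "(g has_real_derivative g1 s) (at s within {0..})" if "0 \<le> s" for s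
      unfolding g_def g1_def by (intro DERIV_cmult DERIV_add power_profile_derivatives \<epsilon>0 that)
    have dg1: "(g1 has_real_derivative g2 s) (at s within {0..})" if "0 \<le> s" for s
      unfolding g1_def g2_def by (intro DERIV_cmult DERIV_add power_profile_derivatives \<epsilon>0 that)
    have cg2: "continuous_on {0..} g2"
      unfolding g2_def using \<epsilon>0 by (intro continuous_intros) (auto simp: add_pos_nonneg less_imp_neq[symmetric])
    have "local_min_on UNIV (\<lambda>y. u y - g ((norm (y - z))\<^sup>2)) x"
    proof -
      have "g ((norm (y - z))\<^sup>2) = M * w y" for y by (simp add: gW w_def)
      moreover have "u x = M * w x" using M(2) wx by simp
      ultimately show ?thesis using touch by (simp add: local_min_on_def)
    qed
    then have visc: "u x powr p \<le> - (2 * real k * g1 s + 4 * s * g2 s)"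
      using radial_test_function[OF _ k(2) super dg dg1 cg2] k(1) unfolding s_def by simp
    define t where "t = \<epsilon> + s"
    have t: "0 < t" "\<epsilon> \<le> t" "s = t - \<epsilon>" using s \<epsilon>0 by (simp_all add: t_def)
    define E where "E = t powr (-a - 3)"
    have E: "0 < E" "t powr (-a - 2) = E * t" "t powr (-a - 1) = E * t * t"
    proof -
      show "0 < E" using t by (simp add: E_def)
      show A: "t powr (-a - 2) = E * t" unfolding E_def by (rule powr_eq_powr_mult_self[OF t(1)]) simp
      show "t powr (-a - 1) = E * t * t"
        unfolding A[symmetric] by (rule powr_eq_powr_mult_self[OF t(1)]) simp
    qed
    define q where "q = \<epsilon> * ((a + 1) * (b + 2)) * t - a / 2 * (t * t) - \<epsilon> * \<epsilon> * ((a + 1) * (a + 2))"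
    have "2 * real k * g1 s + 4 * s * g2 s
      = M * ((2 * real k * (- a * t powr (-a - 1)) + 4 * s * (a * (a + 1) * t powr (-a - 2)))
        + - \<epsilon> * (2 * real k * (- (a + 1) * t powr (-(a + 1) - 1)) + 4 * s * ((a + 1) * (a + 1 + 1) * t powr (-(a + 1) - 2))))"
      by (simp add: g1_def g2_def t_def algebra_simps)
    also have "\<dots> = M * ((4 * a * (a - b) * t powr (-a - 1) - 4 * \<epsilon> * a * (a + 1) * t powr (-a - 2))
        + - \<epsilon> * (4 * (a + 1) * (a + 1 - b) * t powr (-(a + 1) - 1) - 4 * \<epsilon> * (a + 1) * (a + 1 + 1) * t powr (-(a + 1) - 2)))"
      unfolding t_def
      by (subst (1 2) power_profile_operator[OF _ b]) (use s \<epsilon>0 in \<open>simp_all only: add_pos_pos\<close>)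
    also have "-(a + 1) - 1 = -a - 2" by simp
    also have "-(a + 1) - 2 = -a - 3" by simp
    also have "M * ((4 * a * (a - b) * t powr (-a - 1) - 4 * \<epsilon> * a * (a + 1) * t powr (-a - 2))
        + - \<epsilon> * (4 * (a + 1) * (a + 1 - b) * t powr (-a - 2) - 4 * \<epsilon> * (a + 1) * (a + 1 + 1) * t powr (-a - 3)))
      = - (4 * M * E * q)"
      unfolding E(2,3) E_def[symmetric] q_def by (simp add: a_def field_simps)
    finally have visc': "u x powr p \<le> 4 * M * E * q" using visc by simp
    then have "0 < 4 * M * E * q" using upos[of x] by (smt (verit) powr_gt_zero)
    then have q0: "0 < q" by (rule zero_less_mult_pos) (use M(1) E(1) in simp)
    have ab: "a + 2 = (b + 2) + 1/2" by (simp add: a_def)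
    \<comment> \<open>Positivity of \<open>q\<close> confines the touching point to a shell of radius comparable to \<open>sqrt \<epsilon>\<close>.\<close>
    have lower: "\<kappa> * \<epsilon> \<le> s"
    proof -
      have "\<epsilon> * \<epsilon> * ((a + 1) * (a + 2)) < \<epsilon> * ((a + 1) * (b + 2)) * t"
        using q0 a0 t unfolding q_def by (smt (verit) mult_pos_pos half_gt_zero)
      then have "(\<epsilon> * (a + 1)) * (\<epsilon> * (a + 2)) < (\<epsilon> * (a + 1)) * ((b + 2) * t)" by (simp add: algebra_simps)
      then have "\<epsilon> * (a + 2) < (b + 2) * t" 
        using mult_less_cancel_left_pos[of "\<epsilon> * (a + 1)"] \<epsilon>0 a0 by simp
      then have "\<epsilon> < s * (2 * b + 4)" unfolding ab by (simp add: t_def algebra_simps)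
      then show ?thesis using b0 by (simp add: \<kappa>_def pos_divide_le_eq)
    qed
    have upper: "t \<le> T * \<epsilon>"
    proof -
      have "a / 2 * (t * t) < \<epsilon> * ((a + 1) * (b + 2)) * t"
        using q0 a0 \<epsilon>0 unfolding q_def by (smt (verit) mult_pos_pos)
      then have "t * (a / 2 * t) < t * (\<epsilon> * ((a + 1) * (b + 2)))" by (simp add: algebra_simps)
      then have "a / 2 * t < \<epsilon> * ((a + 1) * (b + 2))" using mult_less_cancel_left_pos[OF t(1)] by blast
      then show ?thesis using a0 by (simp add: T_def field_simps)
    qed
    have "u x powr (p - 1) \<le> C / \<epsilon>"
    proof -
      have "q \<le> \<epsilon> * ((a + 1) * (b + 2)) * t"
        unfolding q_def using a0 t \<epsilon>0 by (smt (verit) mult_pos_pos half_gt_zero)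
      then have "4 * M * E * q \<le> 4 * M * E * (\<epsilon> * ((a + 1) * (b + 2)) * t)"
        using M E by (intro mult_left_mono) auto
      then have "u x powr p \<le> 4 * M * E * (\<epsilon> * ((a + 1) * (b + 2)) * t)" using visc' by simp
      also have "\<dots> = u x * (4 * (a + 1) * (b + 2) * (\<epsilon> / (s * t)))"
        unfolding M(2) W_def t_def[symmetric] E(3) using s t by (simp add: field_simps)
      finally have "u x powr (p - 1) \<le> 4 * (a + 1) * (b + 2) * (\<epsilon> / (s * t))"
        using upos[of x] by (simp add: powr_diff pos_divide_le_eq mult.commute)
      also have "\<epsilon> / (s * t) \<le> (2 * b + 4) / \<epsilon>"
      proof -
        have "\<epsilon> \<le> (2 * b + 4) * s" using lower b0 by (simp add: \<kappa>_def pos_divide_le_eq mult.commute)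
        then have "\<epsilon> * \<epsilon> \<le> ((2 * b + 4) * s) * t" using t \<epsilon>0 s b0 by (intro mult_mono) auto
        then have "\<epsilon> * \<epsilon> \<le> (2 * b + 4) * (s * t)" by (simp only: mult.assoc)
        then show ?thesis using s t(1) \<epsilon>0 by (simp add: frac_le_eq divide_le_0_iff mult.commute[of "s * t"])
      qed
      also have "4 * (a + 1) * (b + 2) * ((2 * b + 4) / \<epsilon>) = (4 * (a + 1) * (b + 2) * (2 * b + 4)) / \<epsilon>" by simp
      also have "\<dots> \<le> C / \<epsilon>" using \<epsilon>0 by (intro divide_right_mono) (simp_all add: C_def)
      finally show ?thesis using a0 b0 by (simp add: mult_left_mono)
    qed
    moreover have "u x \<le> C * \<epsilon>"
    proof -
      have e: "-a - 1 = -(a + 1)" by simp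
      have "m1 = u x1 / (1 * (\<epsilon> + 1) powr (-(a + 1)))"
        by (simp only: m1_def w_def x1 W_def one_power2 e)
      also have "\<dots> = u x1 * (\<epsilon> + 1) powr (a + 1)" unfolding powr_minus by (simp add: divide_inverse)
      also have "\<dots> \<le> u x1 * (2 * \<epsilon>) powr (a + 1)"
        using upos[of x1] \<epsilon> a0 by (intro mult_left_mono powr_mono2) auto
      finally have m1_le: "m1 \<le> u x1 * (2 powr (a + 1) * \<epsilon> powr (a + 1))" using \<epsilon>0 by (simp add: powr_mult)
      have "W s \<le> (T * \<epsilon>) * \<epsilon> powr (-a - 1)"
        unfolding W_def using s \<epsilon>0 upper a0 T by (intro mult_mono powr_mono2') (auto simp: t_def)
      then have "M * W s \<le> (u x1 * (2 powr (a + 1) * \<epsilon> powr (a + 1))) * ((T * \<epsilon>) * \<epsilon> powr (-a - 1))"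
        using Mm1 m1_le M m1 Wpos[OF s] upos[of x1] by (intro mult_mono) auto
      also have "\<dots> = (u x1 * T * 2 powr (a + 1)) * \<epsilon> * (\<epsilon> powr (a + 1) * \<epsilon> powr (-a - 1))" by simp
      also have "\<epsilon> powr (a + 1) * \<epsilon> powr (-a - 1) = 1" using \<epsilon>0 by (simp flip: powr_add)
      also have "(u x1 * T * 2 powr (a + 1)) * \<epsilon> * 1 \<le> C * \<epsilon>" using \<epsilon>0 by (simp add: C_def)
      finally show ?thesis by (simp add: M(2))
    qed
    moreover have "s \<le> T * \<epsilon>" using upper \<epsilon>0 by (simp add: t_def)
    ultimately show ?thesis using lower unfolding s_def by blast
  qed
  then show ?thesis using C \<kappa> T by blast
qed

text \<open>At the touching points \<open>u\<^bsup>p-1\<^esup> \<le> C / \<epsilon>\<close>. If \<open>p \<le> 1\<close>, then \<open>u \<le> C \<epsilon>\<close> yields that \<open>\<epsilon>\<^sup>p\<close> stays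
  bounded. If \<open>p > 1\<close>, then \<open>b (p - 1) \<le> 1\<close> and the logarithmic lower bound yields that a positive
  power of \<open>ln (1 + \<kappa> \<epsilon>)\<close> stays bounded.\<close>

lemma liouville_supersolution:
  fixes u :: "real^'n \<Rightarrow> real"
  assumes k: "2 < k" "k < CARD('n)" and p: "0 < p" "p \<le> real k / (real k - 2)"
    and super: "nonneg_viscosity_supersolution k p UNIV u"
  shows "u = (\<lambda>x. 0)"
proof (rule ccontr)
  assume "u \<noteq> (\<lambda>x. 0)"
  then obtain z where "u z \<noteq> 0" by auto
  then have z: "0 < u z" using super by (simp add: nonneg_viscosity_supersolution_def less_le)
  define b where "b = real k / 2 - 1"
  have b: "real k = 2 * (b + 1)" by (simp add: b_def)
  have b0: "0 < b" using k(1) b by simp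
  obtain c0 where c0: "0 < c0" "\<And>x. c0 * (1 + (norm (x - z))\<^sup>2) powr (-b) \<le> u x"
    using supersolution_lower_bound[OF k super z b] by blast
  have upos: "0 < u x" for x
    using c0(2)[of x] c0(1) by (smt (verit) mult_pos_pos powr_gt_zero zero_le_power2)
  obtain c where c: "0 < c"
    "\<And>x. 1 \<le> norm (x - z) \<Longrightarrow> c * (1 + (norm (x - z))\<^sup>2) powr (-b) * ln (1 + (norm (x - z))\<^sup>2) \<le> u x"
    using supersolution_log_lower_bound[OF k p super b c0] by blast
  obtain C \<kappa> T where C: "0 < C" "0 < \<kappa>" "0 < T" and touch:
    "\<And>\<epsilon>. 1 \<le> \<epsilon> \<Longrightarrow> \<exists>x. \<kappa> * \<epsilon> \<le> (norm (x - z))\<^sup>2 \<and> (norm (x - z))\<^sup>2 \<le> T * \<epsilon>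
      \<and> u x powr (p - 1) \<le> C / \<epsilon> \<and> u x \<le> C * \<epsilon>"
    using supersolution_touching_point[OF k super b c0] by blast
  show False
  proof (cases "p \<le> 1")
    case True
    have "\<epsilon> powr p \<le> C powr (2 - p)" if \<epsilon>: "1 \<le> \<epsilon>" for \<epsilon>
    proof -
      obtain x where x: "u x powr (p - 1) \<le> C / \<epsilon>" "u x \<le> C * \<epsilon>" using touch[OF \<epsilon>] by blast
      have "(C * \<epsilon>) powr (p - 1) \<le> u x powr (p - 1)"
        using x(2) upos[of x] True by (intro powr_mono2') auto
      then have "C powr (p - 1) * \<epsilon> powr (p - 1) \<le> C / \<epsilon>" using x(1) C \<epsilon> by (simp add: powr_mult)
      then have "C powr (p - 1) * (\<epsilon> powr (p - 1) * \<epsilon>) \<le> C"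
        using \<epsilon> by (simp add: pos_le_divide_eq mult.assoc)
      moreover have "\<epsilon> powr (p - 1) * \<epsilon> = \<epsilon> powr p" using \<epsilon> powr_add[of \<epsilon> "p - 1" 1] by simp
      ultimately have "C powr (1 - p) * (C powr (p - 1) * \<epsilon> powr p) \<le> C powr (1 - p) * C"
        by (intro mult_left_mono) auto
      moreover have "C powr (1 - p) * (C powr (p - 1) * \<epsilon> powr p) = \<epsilon> powr p"
        using C by (simp add: mult.assoc[symmetric] flip: powr_add)
      moreover have "C powr (1 - p) * C = C powr (2 - p)" using C powr_add[of C "1 - p" 1] by simp
      ultimately show ?thesis by simp
    qed
    moreover define D where "D = C powr (2 - p)"
    ultimately have bound: "\<epsilon> powr p \<le> D" if "1 \<le> \<epsilon>" for \<epsilon> using that by simp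
    have "D + 1 \<le> ((max 1 (D + 1)) powr (1 / p)) powr p"
      using p by (simp add: powr_powr)
    moreover have "1 \<le> (max 1 (D + 1)) powr (1 / p)" using p by (intro ge_one_powr_ge_zero) auto
    ultimately show False using bound[of "(max 1 (D + 1)) powr (1 / p)"] by linarith
  next
    case False
    then have p1: "1 < p" by simp
    have bp: "b * (p - 1) \<le> 1" using p(2) b b0 by (simp add: field_simps)
    define D where "D = C * (1 + T) / c powr (p - 1)"
    have D: "0 \<le> D" using C c by (simp add: D_def)
    have bound: "ln (1 + \<kappa> * \<epsilon>) powr (p - 1) \<le> D" if \<epsilon>: "1 \<le> \<epsilon>" "1 \<le> \<kappa> * \<epsilon>" for \<epsilon>
    proof -
      obtain x where x: "\<kappa> * \<epsilon> \<le> (norm (x - z))\<^sup>2" "(norm (x - z))\<^sup>2 \<le> T * \<epsilon>" "u x powr (p - 1) \<le> C / \<epsilon>"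
        using touch[OF \<epsilon>(1)] by blast
      define t where "t = 1 + (norm (x - z))\<^sup>2"
      have t: "1 \<le> t" "1 + \<kappa> * \<epsilon> \<le> t" "t \<le> (1 + T) * \<epsilon>"
        using x \<epsilon> by (simp_all add: t_def algebra_simps)
      have "1\<^sup>2 \<le> (norm (x - z))\<^sup>2" using x(1) \<epsilon>(2) unfolding one_power2 by linarith
      then have "1 \<le> norm (x - z)" by (rule power2_le_imp_le) simp
      then have low: "c * t powr (-b) * ln t \<le> u x" using c(2) by (simp add: t_def)
      have "t powr (-1) \<le> t powr (-b * (p - 1))" using bp t by (intro powr_mono) auto
      then have "c powr (p - 1) * t powr (-1) * ln t powr (p - 1) \<le> c powr (p - 1) * t powr (-b * (p - 1)) * ln t powr (p - 1)"
        by (intro mult_right_mono mult_left_mono) auto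
      also have "\<dots> = (c * t powr (-b) * ln t) powr (p - 1)"
        using c t by (simp add: powr_mult powr_powr)
      also have "\<dots> \<le> u x powr (p - 1)" using low c t p1 by (intro powr_mono2) auto
      also have "\<dots> \<le> C / \<epsilon>" by (rule x(3))
      finally have "c powr (p - 1) * ln t powr (p - 1) \<le> C / \<epsilon> * t"
        using t by (simp add: powr_minus field_simps)
      also have "\<dots> \<le> C / \<epsilon> * ((1 + T) * \<epsilon>)" using t C \<epsilon> by (intro mult_left_mono) auto
      also have "\<dots> = C * (1 + T)" using \<epsilon> by simp
      finally have "ln t powr (p - 1) \<le> D" using c by (simp add: D_def pos_le_divide_eq mult.commute)
      moreover have "ln (1 + \<kappa> * \<epsilon>) powr (p - 1) \<le> ln t powr (p - 1)"
        using t \<epsilon> p1 by (intro powr_mono2) auto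
      ultimately show ?thesis by linarith
    qed
    define A where "A = (D + 1) powr (1 / (p - 1))"
    define \<epsilon> where "\<epsilon> = max 1 (max (1 / \<kappa>) (exp A / \<kappa>))"
    have \<epsilon>: "1 \<le> \<epsilon>" "1 \<le> \<kappa> * \<epsilon>" "exp A \<le> \<kappa> * \<epsilon>"
    proof -
      have "1 / \<kappa> \<le> \<epsilon>" "exp A / \<kappa> \<le> \<epsilon>" by (simp_all add: \<epsilon>_def)
      then show "1 \<le> \<kappa> * \<epsilon>" "exp A \<le> \<kappa> * \<epsilon>" using C by (simp_all add: pos_divide_le_eq mult.commute)
    qed (simp add: \<epsilon>_def)
    have "exp A \<le> 1 + \<kappa> * \<epsilon>" using \<epsilon> by simp
    then have "A \<le> ln (1 + \<kappa> * \<epsilon>)" using \<epsilon> by (subst ln_ge_iff) auto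
    then have "A powr (p - 1) \<le> ln (1 + \<kappa> * \<epsilon>) powr (p - 1)"
      using p1 by (intro powr_mono2) (auto simp: A_def)
    moreover have "A powr (p - 1) = D + 1" using p1 D by (simp add: A_def powr_powr)
    ultimately show False using bound[OF \<epsilon>(1,2)] by linarith
  qed
qed

theorem theorem1p3:
  fixes k :: nat and p :: real
  assumes "2 < k" and "k < CARD('n::finite)" and "0 < p"
  shows "(p \<le> real k / (real k - 2) \<longrightarrow>
            (\<forall>u :: real^'n \<Rightarrow> real.
               nonneg_viscosity_supersolution k p UNIV u \<longleftrightarrow> u = (\<lambda>x. 0)))
       \<and> (real k / (real k - 2) < p \<longrightarrow>
            (\<exists>u :: real^'n \<Rightarrow> real.
               (\<forall>x. 0 < u x) \<and> classical_supersolution k p UNIV u))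
       \<and> ((real k + 2) / (real k - 2) \<le> p \<longrightarrow>
            (\<exists>u :: real^'n \<Rightarrow> real.
               (\<forall>x. 0 < u x) \<and> classical_solution k p UNIV u))
       \<and> (p \<in> {real k / (real k - 2)<..<(real k + 2) / (real k - 2)} \<longrightarrow>
            \<not> (\<exists>u :: real^'n \<Rightarrow> real.
                 radial u \<and> (\<forall>x. 0 < u x) \<and> classical_solution k p UNIV u))"
proof (intro conjI impI allI iffI)
  fix u :: "real^'n \<Rightarrow> real"
  assume "p \<le> real k / (real k - 2)" "nonneg_viscosity_supersolution k p UNIV u"
  then show "u = (\<lambda>x. 0)" by (rule liouville_supersolution[OF assms])
next
  fix u :: "real^'n \<Rightarrow> real"
  assume "u = (\<lambda>x. 0)"
  then show "nonneg_viscosity_supersolution k p UNIV u" by (simp only: zero_supersolution[OF assms(3)])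
next
  assume "real k / (real k - 2) < p"
  then show "\<exists>u :: real^'n \<Rightarrow> real. (\<forall>x. 0 < u x) \<and> classical_supersolution k p UNIV u"
    by (rule exists_positive_supersolution[OF assms(1,2)])
next
  assume "(real k + 2) / (real k - 2) \<le> p"
  then show "\<exists>u :: real^'n \<Rightarrow> real. (\<forall>x. 0 < u x) \<and> classical_solution k p UNIV u"
    by (rule exists_positive_solution[OF assms(1,2)])
next
  assume "p \<in> {real k / (real k - 2)<..<(real k + 2) / (real k - 2)}"
  then show "\<not> (\<exists>u :: real^'n \<Rightarrow> real. radial u \<and> (\<forall>x. 0 < u x) \<and> classical_solution k p UNIV u)"
    using no_positive_radial_solution[OF assms(1,2)] by auto
qed

end
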